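(* For every $f\in{\cal AE}$ with divisor $D$, the zeros and poles of $f$ can be indexed as $D=((a_n)_{n\in\mathbb{N}},(b_n)_{n\in\mathbb{N}})$ (each zero/pole repeated according to multiplicity) in such a way that $\sup_n|a_n-b_n|<\infty$.
   Context: $\rho_S$ is the spherical metric. A nonconstant meromorphic $f$ on $\mathbb{C}$ is almost elliptic ($f\in{\cal AE}$) if for every $\varepsilon>0$ there is $L<\infty$ such that every disc of radius $L$ contains a point $\tau$ with $\rho_S(f(z+\tau),f(z))<\varepsilon$ for all $z\in\mathbb{C}$. *)

theory Defs
  imports "HOL-Analysis.Analysis"
begin

text \<open>A meromorphic function on the plane is modelled as a map into the Riemann sphere
  complex option, where None denotes the point at infinity.\<close>

definition pole_set :: "(complex \<Rightarrow> complex option) \<Rightarrow> complex set" where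
  "pole_set f = {z. f z = None}"

definition meromorphic_C :: "(complex \<Rightarrow> complex option) \<Rightarrow> bool" where
  "meromorphic_C f \<longleftrightarrow>
     (\<forall>z. \<not> z islimpt pole_set f) \<and>
     (\<lambda>z. the (f z)) holomorphic_on (- pole_set f) \<and>
     (\<forall>p \<in> pole_set f. filterlim (\<lambda>z. the (f z)) at_infinity (at p))"

fun sph_dist :: "complex option \<Rightarrow> complex option \<Rightarrow> real" where
  "sph_dist (Some a) (Some b) = 2 * norm (a - b) / sqrt ((1 + (norm a)\<^sup>2) * (1 + (norm b)\<^sup>2))"
| "sph_dist (Some a) None = 2 / sqrt (1 + (norm a)\<^sup>2)"
| "sph_dist None (Some b) = 2 / sqrt (1 + (norm b)\<^sup>2)"
| "sph_dist None None = 0"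

definition almost_elliptic :: "(complex \<Rightarrow> complex option) \<Rightarrow> bool" where
  "almost_elliptic f \<longleftrightarrow>
     meromorphic_C f \<and> \<not> (\<exists>c. \<forall>z. f z = c) \<and>
     (\<forall>\<epsilon>>0. \<exists>L::real. \<forall>c::complex. \<exists>\<tau>\<in>cball c L.
        \<forall>z. sph_dist (f (z + \<tau>)) (f z) < \<epsilon>)"

definition mero_order :: "(complex \<Rightarrow> complex option) \<Rightarrow> complex \<Rightarrow> int" where
  "mero_order f z0 = (THE n::int. \<exists>g r. r > 0 \<and> g holomorphic_on ball z0 r \<and> g z0 \<noteq> 0 \<and>
       (\<forall>z \<in> ball z0 r - {z0}. f z = Some ((z - z0) powi n * g z)))"

definition zero_mult :: "(complex \<Rightarrow> complex option) \<Rightarrow> complex \<Rightarrow> nat" where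
  "zero_mult f w = nat (mero_order f w)"

definition pole_mult :: "(complex \<Rightarrow> complex option) \<Rightarrow> complex \<Rightarrow> nat" where
  "pole_mult f w = nat (- mero_order f w)"

end

theory Submission
  imports Defs "HOL-Complex_Analysis.Complex_Analysis"
begin

text \<open>
  Almost periodicity makes \<open>f\<close> uniformly continuous for the spherical metric and forbids it to be
  uniformly close to 0 or to infinity on small discs. Hence, on every disc of a fixed small radius,
  \<open>f\<close> or \<open>1 / f\<close> is bounded by 2 and not uniformly small; dividing out the boundedly many zeros
  shows that the argument of \<open>f\<close> changes by a bounded amount along every short segment that avoids
  zeros and poles, no matter how close they are. Take a square grid of side \<open>S\<close> avoiding the divisor. By the
  argument principle, zeros minus poles in a cell is the sum of the argument changes along its
  edges, which are \<open>O(S)\<close>; subtracting the principal arguments at the vertices turns these changes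
  into an integral flow. As zeros are relatively dense, a cell contains at least a constant times
  \<open>S\<^sup>2\<close> of them, so for large \<open>S\<close> the flow is realised by matching zeros only with poles in the
  same or in an adjacent cell.
\<close>

subsection \<open>Change of argument of a bounded holomorphic function\<close>

text \<open>The logarithmic derivative itself admits no uniform bound, because grid edges may pass
  arbitrarily near zeros and poles. Only the imaginary part of its integral is estimated: seen from
  a point off a segment, the segment subtends an angle of at most \<pi>, however near the point is.
  The cost of a short segment is thus governed by the number of nearby zeros and by the zero-free
  factor that remains, and both are controlled by the ratio between an upper bound for |f| and its
  value at one good point nearby. Poles reduce to zeros, since inversion is an isometry of the
  sphere and \<open>1 / f\<close> is therefore almost elliptic too. The roles of zeros and poles
  differ only in the transport: the zeros of a cell must supply the outflow through its four edges,
  and the balance equation then makes the number of arrivals equal to the number of poles.\<close>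

lemma zero_free_log_oscillation:
  fixes F :: "complex \<Rightarrow> complex"
  assumes holF: "F holomorphic_on ball z0 R" and R: "R > 0"
    and nz: "\<And>z. z \<in> ball z0 R \<Longrightarrow> F z \<noteq> 0"
    and bd: "\<And>z. z \<in> ball z0 R \<Longrightarrow> norm (F z) \<le> M"
    and low: "norm (F z0) \<ge> \<eta>" and \<eta>: "\<eta> > 0"
  obtains g where "g holomorphic_on ball z0 R" "\<And>z. z \<in> ball z0 R \<Longrightarrow> F z = exp (g z)"
    "\<And>z. z \<in> cball z0 (R/2) \<Longrightarrow> norm (g z - g z0) \<le> 2 * (ln (M / \<eta>) + 1)"
proof -
  obtain g where g: "g holomorphic_on ball z0 R" "\<And>z. z \<in> ball z0 R \<Longrightarrow> F z = exp (g z)"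
    using contractible_imp_holomorphic_log[OF holF convex_imp_contractible[OF convex_ball]] nz by metis
  \<comment> \<open>The summand 1 makes the upper bound for \<open>Re (g z - g z0)\<close> strict
    and \<open>A\<close> positive even if \<open>M = \<eta>\<close>.\<close>
  define A where "A = ln (M / \<eta>) + 1"
  have z0: "z0 \<in> ball z0 R" using R by simp
  have M: "M \<ge> \<eta>" using bd[OF z0] low by linarith
  have A1: "A \<ge> 1" using M \<eta> by (simp add: A_def)
  have re: "Re (g z - g z0) < A" if "z \<in> ball z0 R" for z
  proof -
    have "exp (Re (g z)) \<le> M" using bd[OF that] g(2)[OF that] by simp
    then have "Re (g z) \<le> ln M" by (metis M \<eta> exp_gt_zero ln_exp ln_le_cancel_iff order_less_le_trans)
    moreover have "exp (Re (g z0)) \<ge> \<eta>" using low g(2)[OF z0] by simp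
    then have "Re (g z0) \<ge> ln \<eta>" by (metis \<eta> exp_gt_zero ln_exp ln_le_cancel_iff)
    ultimately show ?thesis using M \<eta> by (simp add: A_def ln_div)
  qed
  define h where "h = (\<lambda>w. g (z0 + of_real R * w) - g z0)"
  have inb: "z0 + of_real R * w \<in> ball z0 R" if "norm w < 1" for w
    using that R by (simp add: dist_norm norm_mult)
  have reh: "Re (h w) < A" if "norm w < 1" for w
    unfolding h_def using re[OF inb[OF that]] by simp
  have holh: "h holomorphic_on ball 0 1"
  proof -
    have "(\<lambda>w. g (z0 + of_real R * w)) holomorphic_on ball 0 1"
      by (rule holomorphic_on_compose_gen[OF _ g(1), unfolded o_def])
         (auto intro!: holomorphic_intros inb simp del: mem_ball simp: mem_ball_0)
    then show ?thesis unfolding h_def by (intro holomorphic_intros)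
  qed
  \<comment> \<open>Borel-Caratheodory: this Moebius map sends the half plane \<open>Re < A\<close>
    into the unit disc and fixes 0, so the Schwarz lemma turns the one-sided bound on
    \<open>Re h\<close> into a bound on \<open>norm h\<close>.\<close>
  define p where "p = (\<lambda>w. h w / (2 * of_real A - h w))"
  have ne: "2 * of_real A - h w \<noteq> 0" if "norm w < 1" for w
  proof
    assume "2 * of_real A - h w = 0"
    then have "h w = 2 * of_real A" by simp
    then have "Re (h w) = 2 * A" by simp
    then show False using reh[OF that] A1 by linarith
  qed
  have holp: "p holomorphic_on ball 0 1"
    unfolding p_def by (intro holomorphic_intros holh) (use ne in auto)
  have p0: "p 0 = 0" by (simp add: p_def h_def)
  have plt: "norm (p w) < 1" if "norm w < 1" for w
  proof -
    have "(norm (h w))\<^sup>2 < (norm (2 * of_real A - h w))\<^sup>2"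
    proof -
      have "A * Re (h w) < A * A" using reh[OF that] A1 by simp
      then show ?thesis unfolding cmod_power2 by (simp add: power2_eq_square algebra_simps)
    qed
    then have "norm (h w) < norm (2 * of_real A - h w)" by (rule power_less_imp_less_base) simp
    then show ?thesis unfolding p_def norm_divide using ne[OF that]
      by (subst divide_less_eq_1_pos) auto
  qed
  have hb: "norm (h w) \<le> 2 * A" if w: "norm w \<le> 1/2" for w
  proof -
    have w1: "norm w < 1" using w by simp
    have pw: "norm (p w) \<le> 1/2" using Schwarz_Lemma(1)[OF holp p0 plt w1] w by linarith
    have "h w = p w * (2 * of_real A - h w)" using ne[OF w1] by (simp add: p_def)
    then have "norm (h w) = norm (p w) * norm (2 * of_real A - h w)" by (metis norm_mult)
    also have "\<dots> \<le> 1/2 * norm (2 * of_real A - h w)" by (intro mult_right_mono pw) auto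
    also have "norm (2 * of_real A - h w) \<le> 2 * A + norm (h w)"
      using norm_triangle_ineq4[of "2 * of_real A" "h w"] A1 by (simp add: norm_mult)
    finally show ?thesis by simp
  qed
  show ?thesis
  proof (rule that[OF g])
    fix z assume "z \<in> cball z0 (R/2)"
    then have "norm ((z - z0) / of_real R) \<le> 1/2"
      using R by (simp add: dist_norm norm_divide norm_minus_commute field_simps)
    from hb[OF this] show "norm (g z - g z0) \<le> 2 * (ln (M / \<eta>) + 1)"
      using R by (simp add: h_def A_def)
  qed simp
qed

text \<open>Normalised to the value 1 at \<open>u\<close>, the function \<open>z - a\<close> cannot
  reach the nonpositive reals on the segment, since \<open>a\<close> would then lie between
  \<open>u\<close> and \<open>z\<close>. Hence the principal logarithm is a primitive along the
  whole segment, and the bound does not involve the distance from \<open>a\<close> to it.\<close>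

lemma Im_contour_integral_inverse_le_pi:
  assumes "a \<notin> closed_segment u v"
  shows "(\<lambda>z. 1 / (z - a)) contour_integrable_on linepath u v"
    and "\<bar>Im (contour_integral (linepath u v) (\<lambda>z. 1 / (z - a)))\<bar> \<le> pi"
proof -
  have ua: "u - a \<noteq> 0" using assms by auto
  define q where "q = (\<lambda>z. (z - a) / (u - a))"
  have q: "q z \<notin> \<real>\<^sub>\<le>\<^sub>0" if z: "z \<in> closed_segment u v" for z
  proof
    assume neg: "q z \<in> \<real>\<^sub>\<le>\<^sub>0"
    then obtain r where r: "q z = of_real r" "r \<le> 0" by (auto elim: nonpos_Reals_cases)
    have zr: "z = a + of_real r * (u - a)" using r(1) ua by (simp add: q_def field_simps)
    \<comment> \<open>Solves \<open>(1 - t) * r + t = 0\<close>, which expresses \<open>a\<close> as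
      a convex combination of \<open>z\<close> and \<open>u\<close>.\<close>
    define t where "t = - r / (1 - r)"
    have t: "0 \<le> t" "t \<le> 1" using r(2) by (auto simp: t_def field_simps)
    have "a = (1 - t) *\<^sub>R z + t *\<^sub>R u"
    proof -
      have "(1 - t) = 1 / (1 - r)" using r(2) by (simp add: t_def field_simps)
      then have e: "(1 - t) * r + t = 0" using r(2) by (simp add: t_def field_simps)
      have "(1 - t) *\<^sub>R z + t *\<^sub>R u = a + of_real ((1 - t) * r + t) * (u - a)"
        by (simp add: zr scaleR_conv_of_real algebra_simps)
      then show ?thesis using e by simp
    qed
    then have "a \<in> closed_segment z u" using t unfolding in_segment by blast
    also have "closed_segment z u \<subseteq> closed_segment u v"
      using z by (simp add: subset_closed_segment)
    finally show False using assms by simp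
  qed
  have ne: "z - a \<noteq> 0" if "z \<in> closed_segment u v" for z using that assms by auto
  have "((\<lambda>z. Ln (q z)) has_field_derivative 1 / (z - a)) (at z within closed_segment u v)"
    if "z \<in> closed_segment u v" for z
  proof -
    have "(q has_field_derivative 1 / (u - a)) (at z within closed_segment u v)"
      unfolding q_def using ua by (auto intro!: derivative_eq_intros)
    from DERIV_chain2[OF has_field_derivative_Ln[OF q[OF that]] this]
    show ?thesis using ne[OF that] ua by (simp add: q_def divide_simps)
  qed
  then have "((\<lambda>z. 1 / (z - a)) has_contour_integral (Ln (q v) - Ln (q u))) (linepath u v)"
    using contour_integral_primitive[of "closed_segment u v" "\<lambda>z. Ln (q z)" "\<lambda>z. 1/(z-a)" "linepath u v"]
    by simp
  moreover have "Ln (q u) = 0" using ua by (simp add: q_def)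
  ultimately have h: "((\<lambda>z. 1 / (z - a)) has_contour_integral Ln (q v)) (linepath u v)" by simp
  then show "(\<lambda>z. 1 / (z - a)) contour_integrable_on linepath u v"
    by (auto simp: contour_integrable_on_def)
  have "q v \<noteq> 0" using ne[of v] ua by (simp add: q_def)
  then have "\<bar>Im (Ln (q v))\<bar> \<le> pi" using mpi_less_Im_Ln[of "q v"] Im_Ln_le_pi[of "q v"] by linarith
  then show "\<bar>Im (contour_integral (linepath u v) (\<lambda>z. 1 / (z - a)))\<bar> \<le> pi"
    using contour_integral_unique[OF h] by simp
qed

lemma holomorphic_imp_continuous_log_deriv:
  assumes "F holomorphic_on S" "open S" "K \<subseteq> S" "\<And>z. z \<in> K \<Longrightarrow> F z \<noteq> 0"
  shows "continuous_on K (\<lambda>z. deriv F z / F z)"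
  using assms
  by (intro continuous_intros holomorphic_on_imp_continuous_on)
     (auto intro: holomorphic_on_subset holomorphic_deriv)

lemma log_deriv_integral_exp:
  assumes holg: "g holomorphic_on S" and S: "open S" and seg: "closed_segment u v \<subseteq> S"
    and F: "\<And>z. z \<in> S \<Longrightarrow> F z = exp (g z)"
  shows "contour_integral (linepath u v) (\<lambda>z. deriv F z / F z) = g v - g u"
proof -
  have d: "(g has_field_derivative deriv F z / F z) (at z)" if z: "z \<in> S" for z
  proof -
    have gd: "(g has_field_derivative deriv g z) (at z)"
      using holg S z by (rule holomorphic_derivI)
    have "(F has_field_derivative exp (g z) * deriv g z) (at z)"
      by (rule has_field_derivative_transform_within_open[OF DERIV_chain2[OF DERIV_exp gd] S z])
         (simp add: F)
    then have "deriv F z / F z = deriv g z" using F[OF z] by (simp add: DERIV_imp_deriv)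
    then show ?thesis using gd by simp
  qed
  show ?thesis
    using contour_integral_unique[OF contour_integral_primitive[of S g "\<lambda>z. deriv F z / F z" "linepath u v"]]
      d seg by (auto intro: has_field_derivative_at_within)
qed

text \<open>Both end points are compared with the centre, which doubles the oscillation bound. The
  ratio \<open>M / \<eta>\<close> is measured by an exponent \<open>k\<close> of 2 so that it can
  serve as the induction variable once zeros are divided out.\<close>

lemma log_deriv_integral_bound_zero_free:
  fixes F :: "complex \<Rightarrow> complex"
  assumes R: "R > 0" and \<eta>: "\<eta> > 0" and hol: "F holomorphic_on ball z0 R"
    and nz: "\<And>z. z \<in> ball z0 R \<Longrightarrow> F z \<noteq> 0"
    and bd: "\<And>z. z \<in> ball z0 R \<Longrightarrow> norm (F z) \<le> M"
    and low: "norm (F z0) \<ge> \<eta>" and M: "M \<le> 2 ^ k * \<eta>"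
    and u: "u \<in> cball z0 (R / 2)" and v: "v \<in> cball z0 (R / 2)"
  shows "\<bar>Im (contour_integral (linepath u v) (\<lambda>z. deriv F z / F z))\<bar> \<le> 4 * (real k + 1)"
proof -
  obtain g where g: "g holomorphic_on ball z0 R" "\<And>z. z \<in> ball z0 R \<Longrightarrow> F z = exp (g z)"
    and gb: "\<And>z. z \<in> cball z0 (R/2) \<Longrightarrow> norm (g z - g z0) \<le> 2 * (ln (M / \<eta>) + 1)"
    using zero_free_log_oscillation[OF hol R nz bd low \<eta>] by metis
  have "closed_segment u v \<subseteq> cball z0 (R/2)"
    using u v by (intro closed_segment_subset) auto
  then have seg: "closed_segment u v \<subseteq> ball z0 R" using R by fastforce
  have "M \<ge> \<eta>" using bd[of z0] low R by simp
  then have Mp: "M / \<eta> > 0" using \<eta> by simp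
  have "M / \<eta> \<le> 2 ^ k" using M \<eta> by (simp add: field_simps)
  then have "ln (M / \<eta>) \<le> ln (2 ^ k)" using Mp by (subst ln_le_cancel_iff) auto
  also have "\<dots> \<le> real k * 1"
    using ln_2_less_1 by (simp add: ln_realpow mult_left_le)
  finally have L: "ln (M / \<eta>) \<le> real k" by simp
  have "norm (g v - g u) \<le> norm (g v - g z0) + norm (g u - g z0)"
    by (metis dist_norm dist_triangle2)
  also have "\<dots> \<le> 2 * (real k + 1) + 2 * (real k + 1)"
    by (intro add_mono order_trans[OF gb[OF u]] order_trans[OF gb[OF v]]) (use L in simp_all)
  also have "\<dots> = 4 * (real k + 1)" by simp
  finally have "norm (g v - g u) \<le> 4 * (real k + 1)" .
  moreover have "\<bar>Im (g v - g u)\<bar> \<le> norm (g v - g u)" by (rule abs_Im_le_cmod)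
  ultimately show ?thesis
    using log_deriv_integral_exp[OF g(1) open_ball seg g(2)] by simp
qed

text \<open>Each zero near the centre is divided out at the price of an angle of at most \<open>\<pi>\<close>; since
  every division reduces \<open>M / \<eta>\<close> by the factor 3, only boundedly many zeros occur.\<close>
lemma log_deriv_integral_bound:
  fixes F :: "complex \<Rightarrow> complex"
  assumes "R > 0" "\<eta> > 0"
    and "F holomorphic_on ball z0 (5 * R)"
    and "\<And>z. z \<in> sphere z0 (4 * R) \<Longrightarrow> norm (F z) \<le> M"
    and "norm (F z0) \<ge> \<eta>" and "M \<le> 2 ^ k * \<eta>"
    and "u \<in> cball z0 (R / 2)" "v \<in> cball z0 (R / 2)"
    and "\<And>z. z \<in> closed_segment u v \<Longrightarrow> F z \<noteq> 0"
  shows "\<bar>Im (contour_integral (linepath u v) (\<lambda>z. deriv F z / F z))\<bar> \<le> 8 * (real k + 1)"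
  using assms
proof (induction k arbitrary: F M \<eta> rule: nat_less_induct)
  case (1 k F M \<eta>)
  note R = \<open>R > 0\<close> and \<eta> = \<open>\<eta> > 0\<close> and hol = \<open>F holomorphic_on ball z0 (5 * R)\<close>
  note low = \<open>norm (F z0) \<ge> \<eta>\<close> and Mk = \<open>M \<le> 2 ^ k * \<eta>\<close>
  \<comment> \<open>The bound is assumed on the sphere only, because after division by
    \<open>z - a\<close> it can be derived directly only away from \<open>a\<close>; the maximum
    principle carries it inside.\<close>
  have maxmod: "norm (G z) \<le> B"
    if "G holomorphic_on ball z0 (5 * R)" "\<And>z. z \<in> sphere z0 (4 * R) \<Longrightarrow> norm (G z) \<le> B"
      "z \<in> cball z0 (4 * R)" for G :: "complex \<Rightarrow> complex" and B z
  proof (rule maximum_modulus_frontier[of G "cball z0 (4 * R)"])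
    show "G holomorphic_on interior (cball z0 (4 * R))"
      by (rule holomorphic_on_subset[OF that(1)]) (use R in auto)
    show "continuous_on (closure (cball z0 (4 * R))) G"
      using R by (intro holomorphic_on_imp_continuous_on holomorphic_on_subset[OF that(1)]) auto
  qed (use that R in auto)
  show ?case
  proof (cases "\<exists>a\<in>ball z0 R. F a = 0")
    case False
    have "\<bar>Im (contour_integral (linepath u v) (\<lambda>z. deriv F z / F z))\<bar> \<le> 4 * (real k + 1)"
    proof (rule log_deriv_integral_bound_zero_free[where \<eta> = \<eta> and M = M, OF R \<eta>])
      show "F holomorphic_on ball z0 R"
        by (rule holomorphic_on_subset[OF hol]) (use R in auto)
      show "norm (F z) \<le> M" if "z \<in> ball z0 R" for z
        using maxmod[OF hol "1.prems"(4)] that R by auto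
    qed (use False low Mk "1.prems" in auto)
    then show ?thesis by simp
  next
    case True
    then obtain a where a: "a \<in> ball z0 R" "F a = 0" by blast
    define G where "G = (\<lambda>z. if z = a then deriv F a else F z / (z - a))"
    have a5: "a \<in> ball z0 (5 * R)" using a R by auto
    have holG: "G holomorphic_on ball z0 (5 * R)"
    proof -
      have "(\<lambda>z. if z = a then deriv F a else F z / (z - a) - F a / (z - a)) holomorphic_on ball z0 (5 * R)"
        by (rule pole_theorem_open[OF hol open_ball]) auto
      then show ?thesis using a(2) by (simp add: G_def cong: if_cong)
    qed
    have FG: "F z = (z - a) * G z" for z using a(2) by (auto simp: G_def)
    have az0: "norm (z0 - a) < R" using a(1) by (simp add: dist_norm)
    have z0a: "z0 \<noteq> a" using low \<eta> a(2) by auto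
    \<comment> \<open>Source of the factor 3: on the sphere of radius \<open>4 * R\<close> the
      distance to \<open>a\<close> is at least \<open>3 * R\<close>, whereas the centre is closer
      than \<open>R\<close> to \<open>a\<close>.\<close>
    have Gs: "norm (G z) \<le> M / (3 * R)" if z: "z \<in> sphere z0 (4 * R)" for z
    proof -
      have "dist z0 z \<le> dist z0 a + dist a z" by (rule dist_triangle)
      then have "3 * R \<le> norm (z - a)" using z a(1) by (simp add: dist_norm norm_minus_commute)
      moreover have "norm (z - a) * norm (G z) \<le> M" using "1.prems"(4)[OF z] FG[of z] by (simp add: norm_mult)
      ultimately have "3 * R * norm (G z) \<le> M" by (meson mult_right_mono norm_ge_zero order_trans)
      then show ?thesis using R by (simp add: field_simps)
    qed
    have G0: "\<eta> / R \<le> norm (G z0)"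
    proof -
      have "norm (G z0) * norm (z0 - a) \<le> norm (G z0) * R"
        using az0 by (intro mult_left_mono) auto
      then have "\<eta> \<le> norm (G z0) * R" using low FG[of z0] by (simp add: norm_mult mult.commute)
      then show ?thesis using R by (simp add: field_simps)
    qed
    \<comment> \<open>Comparing \<open>G\<close> at the centre with its bound on the sphere shows
      that a zero forces \<open>3 \<le> 2 ^ k\<close>; so \<open>k\<close> is positive and can be
      lowered.\<close>
    have "norm (G z0) \<le> M / (3 * R)" using maxmod[OF holG Gs] R by auto
    then have "\<eta> / R \<le> M / (3 * R)" using G0 by linarith
    then have "3 * \<eta> \<le> M" using R by (simp add: field_simps)
    then have "3 * \<eta> \<le> 2 ^ k * \<eta>" using Mk by linarith
    then have "(3::real) \<le> 2 ^ k" using \<eta> by simp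
    then obtain j where k: "k = Suc j" by (cases k) auto
    have Gnz: "G z \<noteq> 0" if "z \<in> closed_segment u v" for z
      using FG[of z] "1.prems"(9)[OF that] by auto
    have IH: "\<bar>Im (contour_integral (linepath u v) (\<lambda>z. deriv G z / G z))\<bar> \<le> 8 * (real j + 1)"
    proof -
      \<comment> \<open>Of the gained factor 3 only 2 is spent, since \<open>k\<close> drops by
        one.\<close>
      have "M / (3 * R) \<le> 2 ^ j * (\<eta> / R)"
      proof -
        have "0 \<le> 2 ^ j * \<eta>" using \<eta> by simp
        then have "M \<le> 3 * (2 ^ j * \<eta>)" using Mk unfolding k power_Suc mult.assoc by linarith
        then show ?thesis using R by (simp add: field_simps)
      qed
      moreover have "\<eta> / R > 0" using \<eta> R by simp
      moreover have "j < k" using k by simp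
      ultimately show ?thesis
        using "1.IH" R holG Gs G0 "1.prems"(7,8) Gnz by blast
    qed
    have seg: "closed_segment u v \<subseteq> ball z0 (5 * R)"
      using "1.prems"(7,8) R by (intro closed_segment_subset) auto
    have anot: "a \<notin> closed_segment u v" using a(2) "1.prems"(9) by blast
    have cG: "(\<lambda>z. deriv G z / G z) contour_integrable_on linepath u v"
      by (intro contour_integrable_continuous_linepath
            holomorphic_imp_continuous_log_deriv[OF holG open_ball seg] Gnz)
    have "contour_integral (linepath u v) (\<lambda>z. deriv F z / F z)
        = contour_integral (linepath u v) (\<lambda>z. 1 / (z - a) + deriv G z / G z)"
    proof (rule contour_integral_eq)
      fix z assume "z \<in> path_image (linepath u v)"
      then have z: "z \<in> closed_segment u v" by simp
      then have zb: "z \<in> ball z0 (5 * R)" and za: "z \<noteq> a" using seg anot by auto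
      have dG: "(G has_field_derivative deriv G z) (at z)"
        using holG open_ball zb by (rule holomorphic_derivI)
      have "((\<lambda>z. (z - a) * G z) has_field_derivative (G z + (z - a) * deriv G z)) (at z)"
        by (auto intro!: derivative_eq_intros dG)
      moreover have "(\<lambda>z. (z - a) * G z) = F" using FG by auto
      ultimately have dF: "deriv F z = G z + (z - a) * deriv G z" by (simp add: DERIV_imp_deriv)
      show "deriv F z / F z = 1 / (z - a) + deriv G z / G z"
        unfolding dF FG[of z] using za Gnz[OF z] by (simp add: add_divide_distrib)
    qed
    also have "\<dots> = contour_integral (linepath u v) (\<lambda>z. 1 / (z - a))
        + contour_integral (linepath u v) (\<lambda>z. deriv G z / G z)"
      by (intro contour_integral_add Im_contour_integral_inverse_le_pi(1) anot cG)
    finally have "\<bar>Im (contour_integral (linepath u v) (\<lambda>z. deriv F z / F z))\<bar> \<le> pi + 8 * (real j + 1)"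
      using Im_contour_integral_inverse_le_pi(2)[OF anot] IH by simp
    \<comment> \<open>The angle \<pi> paid for \<open>a\<close> fits into the 8 by which the bound
      grows from \<open>j\<close> to \<open>k\<close>.\<close>
    then show ?thesis using pi_less_4 k by simp
  qed
qed

text \<open>A two-constants estimate, obtained from Montel's theorem and the identity theorem.\<close>
lemma small_propagates:
  assumes r: "r > 0" and \<omega>: "\<omega> > 0"
  obtains \<eta> where "\<eta> > 0"
    "\<And>F c z. \<lbrakk>F holomorphic_on ball c (4 * r); \<And>z. z \<in> ball c (4 * r) \<Longrightarrow> norm (F z) \<le> 2;
       \<And>z. z \<in> ball c r \<Longrightarrow> norm (F z) < \<eta>; z \<in> cball c (2 * r)\<rbrakk> \<Longrightarrow> norm (F z) < \<omega>"
proof (rule ccontr)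
  assume neg: "\<not> thesis"
  note witness = that
  define P where "P = (\<lambda>(\<eta>::real) F. F holomorphic_on ball 0 (4 * r) \<and> (\<forall>z\<in>ball 0 (4 * r). norm (F z) \<le> 2)
      \<and> (\<forall>z\<in>ball 0 r. norm (F z) < \<eta>) \<and> (\<exists>z\<in>cball 0 (2 * r). norm (F z) \<ge> \<omega>))"
  \<comment> \<open>Translating the centre to 0 puts all counterexamples on one disc, so that they
    form a normal family.\<close>
  have ex: "\<exists>F. P \<eta> F" if \<eta>: "\<eta> > 0" for \<eta>
  proof -
    obtain F c z where F: "F holomorphic_on ball c (4 * r)" "\<And>z. z \<in> ball c (4 * r) \<Longrightarrow> norm (F z) \<le> 2"
       "\<And>z. z \<in> ball c r \<Longrightarrow> norm (F z) < \<eta>" "z \<in> cball c (2 * r)" "\<not> norm (F z) < \<omega>"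
      using neg witness[OF \<eta>] by blast
    define G where "G = (\<lambda>w. F (c + w))"
    have inb: "c + w \<in> ball c s \<longleftrightarrow> w \<in> ball 0 s" for w s by (simp add: dist_norm)
    have "G holomorphic_on ball 0 (4 * r)"
      unfolding G_def
      by (rule holomorphic_on_compose_gen[OF _ F(1), unfolded o_def])
         (auto intro!: holomorphic_intros simp: inb simp del: mem_ball)
    moreover have "z - c \<in> cball 0 (2 * r)" "G (z - c) = F z"
      using F(4) by (auto simp: dist_norm norm_minus_commute G_def)
    ultimately have "P \<eta> G" unfolding P_def using F(2,3,5) inb by (force simp: G_def)
    then show ?thesis by blast
  qed
  define Fn where "Fn = (\<lambda>n::nat. SOME F. P (1 / (real n + 1)) F)"
  have Fn: "P (1 / (real n + 1)) (Fn n)" for n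
    using someI_ex[OF ex[of "1 / (real n + 1)"]] by (simp add: Fn_def)
  obtain g s where g: "g holomorphic_on ball 0 (4 * r)" and s: "strict_mono (s :: nat \<Rightarrow> nat)"
    and lim: "\<And>x. x \<in> ball 0 (4 * r) \<Longrightarrow> (\<lambda>n. Fn (s n) x) \<longlonglongrightarrow> g x"
    and ul: "\<And>K. \<lbrakk>compact K; K \<subseteq> ball 0 (4 * r)\<rbrakk> \<Longrightarrow> uniform_limit K (Fn \<circ> s) g sequentially"
  proof (rule Montel[of "ball 0 (4 * r)" "range Fn" Fn])
    show "\<exists>B. \<forall>h\<in>range Fn. \<forall>z\<in>K. norm (h z) \<le> B" if "K \<subseteq> ball 0 (4 * r)" for K
      using Fn that unfolding P_def by blast
  qed (use Fn in \<open>auto simp: P_def\<close>)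
  \<comment> \<open>The limit vanishes on the small disc, hence on the large one by the identity
    theorem. Uniform convergence on \<open>cball 0 (2 * r)\<close> then contradicts the values of
    modulus at least \<omega> there.\<close>
  have g0: "g x = 0" if x: "x \<in> ball 0 r" for x
  proof -
    have "(\<lambda>n. Fn (s n) x) \<longlonglongrightarrow> 0"
    proof (rule Lim_null_comparison)
      show "(\<lambda>n. 1 / (real n + 1)) \<longlonglongrightarrow> 0" by real_asymp
      have "norm (Fn (s n) x) \<le> 1 / (real n + 1)" for n
      proof -
        have "norm (Fn (s n) x) \<le> 1 / (real (s n) + 1)" using Fn[of "s n"] x unfolding P_def by force
        also have "\<dots> \<le> 1 / (real n + 1)" using seq_suble[OF s, of n] by (intro divide_left_mono) auto
        finally show ?thesis .
      qed
      then show "\<forall>\<^sub>F n in sequentially. norm (Fn (s n) x) \<le> 1 / (real n + 1)" by simp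
    qed
    moreover have "x \<in> ball 0 (4 * r)" using x r by auto
    ultimately show ?thesis using lim LIMSEQ_unique by blast
  qed
  have g00: "g x = 0" if "x \<in> ball 0 (4 * r)" for x
  proof (rule analytic_continuation[OF g open_ball connected_ball, of "ball 0 r" 0])
    show "(0::complex) islimpt ball 0 r" using r by (simp add: islimpt_ball)
  qed (use r that g0 in auto)
  have "cball (0::complex) (2 * r) \<subseteq> ball 0 (4 * r)" using r by auto
  from uniform_limitD[OF ul[OF compact_cball this] \<omega>]
  obtain n where n: "\<forall>x\<in>cball 0 (2 * r). dist (Fn (s n) x) (g x) < \<omega>"
    by (auto simp: eventually_sequentially)
  obtain z where z: "z \<in> cball 0 (2 * r)" "norm (Fn (s n) z) \<ge> \<omega>" using Fn[of "s n"] unfolding P_def by blast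
  have "z \<in> ball 0 (4 * r)" using z(1) r by auto
  then show False using n z g00[of z] by force
qed

subsection \<open>Transport on the square grid\<close>

text \<open>Fibres over different \<open>q\<close> are disjoint on both sides, so bijections chosen
  fibre by fibre glue together.\<close>

lemma bij_betw_from_equal_fibres:
  assumes fin: "\<And>q. finite {x \<in> A. g x = q}" "\<And>q. finite {y \<in> B. h y = q}"
    and card: "\<And>q. card {x \<in> A. g x = q} = card {y \<in> B. h y = q}"
  obtains \<phi> where "bij_betw \<phi> A B" "\<And>x. x \<in> A \<Longrightarrow> h (\<phi> x) = g x"
proof -
  have "\<forall>q. \<exists>e. bij_betw e {x \<in> A. g x = q} {y \<in> B. h y = q}"
    using finite_same_card_bij[OF fin card] by blast
  then obtain e where e: "\<And>q. bij_betw (e q) {x \<in> A. g x = q} {y \<in> B. h y = q}" by metis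
  have im: "e (g x) x \<in> B \<and> h (e (g x) x) = g x" if "x \<in> A" for x
    using bij_betwE[OF e[of "g x"]] that by blast
  have "bij_betw (\<lambda>x. e (g x) x) A B"
  proof (rule bij_betwI')
    fix x y assume "x \<in> A" "y \<in> A"
    then show "(e (g x) x = e (g y) y) = (x = y)"
      using im e[of "g x"] unfolding bij_betw_def inj_on_def by (metis (mono_tags, lifting) mem_Collect_eq)
  next
    fix y assume "y \<in> B"
    then have "y \<in> e (h y) ` {x \<in> A. g x = h y}" using e[of "h y"] unfolding bij_betw_def by blast
    then show "\<exists>x\<in>A. y = e (g x) x" by force
  qed (use im in blast)
  then show ?thesis using that im by blast
qed

text \<open>An integral flow between the cells of the square grid, bounded by \<open>K\<close>, is realised by sending
  points of each cell to the neighbouring cells; this needs at least \<open>4 * K\<close> points per cell.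
  \<open>H i j\<close> and \<open>W i j\<close> are the flows leaving the cell \<open>(i, j)\<close> through its bottom edge and entering
  it through its left edge.\<close>
lemma bounded_transport:
  fixes cz :: "'a \<Rightarrow> int \<times> int" and cp :: "'b \<Rightarrow> int \<times> int" and H W :: "int \<Rightarrow> int \<Rightarrow> int"
  assumes finz: "\<And>q. finite {x \<in> Z. cz x = q}" and finp: "\<And>q. finite {x \<in> P. cp x = q}"
    and bal: "\<And>i j. int (card {x \<in> Z. cz x = (i, j)}) - int (card {x \<in> P. cp x = (i, j)})
        = H i j + W (i + 1) j - H i (j + 1) - W i j"
    and HK: "\<And>i j. \<bar>H i j\<bar> \<le> K" and WK: "\<And>i j. \<bar>W i j\<bar> \<le> K"
    and many: "\<And>q. 4 * K \<le> int (card {x \<in> Z. cz x = q})"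
  obtains \<phi> where "bij_betw \<phi> Z P"
    "\<And>x. x \<in> Z \<Longrightarrow> \<bar>fst (cp (\<phi> x)) - fst (cz x)\<bar> \<le> 1 \<and> \<bar>snd (cp (\<phi> x)) - snd (cz x)\<bar> \<le> 1"
proof -
  \<comment> \<open>The directions are: stay, down, right, up, left; \<open>out\<close> below lists
    the numbers of points in the same order.\<close>
  define dir :: "nat \<Rightarrow> int \<times> int" where "dir = (\<lambda>d. [(0,0), (0,-1), (1,0), (0,1), (-1,0)] ! d)"
  \<comment> \<open>Only the positive part of the flow across an edge is an outflow; the negative
    part is an outflow of the neighbouring cell.\<close>
  define leave where "leave = (\<lambda>i j. nat (H i j) + nat (W (i+1) j) + nat (- H i (j+1)) + nat (- W i j))"
  define out where "out = (\<lambda>(i,j) d. [card {x \<in> Z. cz x = (i,j)} - leave i j,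
      nat (H i j), nat (W (i+1) j), nat (- H i (j+1)), nat (- W i j)] ! d)"
  have five: "{..<5::nat} = {0,1,2,3,4}" by auto
  have leave_le: "leave i j \<le> card {x \<in> Z. cz x = (i,j)}" for i j
    using HK[of i j] HK[of i "j+1"] WK[of i j] WK[of "i+1" j] many[of "(i,j)"]
    unfolding leave_def by linarith
  have out_sum: "(\<Sum>d<5. out q d) = card {x \<in> Z. cz x = q}" for q
    using leave_le[of "fst q" "snd q"] unfolding five by (cases q) (simp add: out_def leave_def)
  \<comment> \<open>Arrivals in \<open>q\<close> by direction \<open>d\<close> are departures from
    \<open>q - dir d\<close>. With \<open>n x - n (- x) = x\<close> the balance equation turns their
    total into the number of points of \<open>P\<close>.\<close>
  have in_sum: "(\<Sum>d<5. out (q - dir d) d) = card {x \<in> P. cp x = q}" for q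
  proof (cases q)
    case (Pair i j)
    define n where "n = (\<lambda>x. int (nat x))"
    have n: "n x = x + n (- x)" for x by (simp add: n_def)
    have "int (\<Sum>d<5. out (q - dir d) d) = int (card {x \<in> Z. cz x = (i,j)}) - int (leave i j)
        + (n (H i (j+1)) + n (W i j) + n (- H i j) + n (- W (i+1) j))"
      using leave_le[of i j] unfolding five Pair n_def by (simp add: out_def dir_def of_nat_diff)
    also have "int (leave i j) = n (H i j) + n (W (i+1) j) + n (- H i (j+1)) + n (- W i j)"
      by (simp only: leave_def n_def of_nat_add)
    also have "int (card {x \<in> Z. cz x = (i,j)}) - \<dots>
        + (n (H i (j+1)) + n (W i j) + n (- H i j) + n (- W (i+1) j)) = int (card {x \<in> P. cp x = q})"
      using bal[of i j] n[of "H i j"] n[of "W (i+1) j"] n[of "H i (j+1)"] n[of "W i j"]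
      unfolding Pair by linarith
    finally have "int (\<Sum>d<5. out (q - dir d) d) = int (card {x \<in> P. cp x = q})" .
    then show ?thesis by (simp only: of_nat_eq_iff)
  qed
  \<comment> \<open>One token for each planned move: the \<open>k\<close>-th point leaving
    \<open>q\<close> in direction \<open>d\<close>. Counted by source the tokens match
    \<open>Z\<close>, counted by target they match \<open>P\<close>, so the bijection factors
    through \<open>T\<close>.\<close>
  define T where "T = {(q, d, k). d < 5 \<and> k < out q d}"
  define src where "src = (\<lambda>t :: (int \<times> int) \<times> nat \<times> nat. fst t)"
  define tgt where "tgt = (\<lambda>t :: (int \<times> int) \<times> nat \<times> nat. fst t + dir (fst (snd t)))"
  have src_fib: "{t \<in> T. src t = q} = Pair q ` Sigma {..<5} (\<lambda>d. {..<out q d})" for q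
    by (auto simp: T_def src_def)
  have tgt_fib: "{t \<in> T. tgt t = q} = (\<lambda>(d, k). (q - dir d, d, k)) ` Sigma {..<5} (\<lambda>d. {..<out (q - dir d) d})" for q
    by (force simp: T_def tgt_def)
  have src_card: "card {t \<in> T. src t = q} = card {x \<in> Z. cz x = q}" for q
    unfolding src_fib using out_sum[of q] by (subst card_image) (auto simp: inj_on_def)
  have tgt_card: "card {t \<in> T. tgt t = q} = card {x \<in> P. cp x = q}" for q
    unfolding tgt_fib using in_sum[of q] by (subst card_image) (auto simp: inj_on_def)
  obtain \<alpha> where \<alpha>: "bij_betw \<alpha> Z T" "\<And>x. x \<in> Z \<Longrightarrow> src (\<alpha> x) = cz x"
  proof (rule bij_betw_from_equal_fibres[of Z cz T src])
    show "finite {t \<in> T. src t = q}" for q unfolding src_fib by simp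
  qed (use finz src_card in auto)
  obtain \<beta> where \<beta>: "bij_betw \<beta> T P" "\<And>t. t \<in> T \<Longrightarrow> cp (\<beta> t) = tgt t"
  proof (rule bij_betw_from_equal_fibres[of T tgt P cp])
    show "finite {t \<in> T. tgt t = q}" for q unfolding tgt_fib by simp
  qed (use finp tgt_card in auto)
  have dir_le: "\<bar>fst (dir d)\<bar> \<le> 1 \<and> \<bar>snd (dir d)\<bar> \<le> 1" if "d < 5" for d
  proof -
    have "d \<in> {0,1,2,3,4}" using that five by blast
    then show ?thesis by (auto simp: dir_def)
  qed
  show ?thesis
  proof (rule that[of "\<beta> \<circ> \<alpha>"])
    show "bij_betw (\<beta> \<circ> \<alpha>) Z P" using \<alpha>(1) \<beta>(1) by (rule bij_betw_trans)
    fix x assume x: "x \<in> Z"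
    then have t: "\<alpha> x \<in> T" using \<alpha>(1) bij_betwE by blast
    have "cp (\<beta> (\<alpha> x)) = cz x + dir (fst (snd (\<alpha> x)))"
      using \<beta>(2)[OF t] \<alpha>(2)[OF x] by (simp add: src_def tgt_def)
    moreover have "fst (snd (\<alpha> x)) < 5" using t by (auto simp: T_def)
    ultimately show "\<bar>fst (cp ((\<beta> \<circ> \<alpha>) x)) - fst (cz x)\<bar> \<le> 1 \<and> \<bar>snd (cp ((\<beta> \<circ> \<alpha>) x)) - snd (cz x)\<bar> \<le> 1"
      using dir_le[of "fst (snd (\<alpha> x))"] by simp
  qed
qed

subsection \<open>The spherical metric\<close>

text \<open>Inverse stereographic projection onto the unit sphere, with infinity at the north
  pole.\<close>

fun chordal :: "complex option \<Rightarrow> complex \<times> real" where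
  "chordal None = (0, 1)"
| "chordal (Some w) = (2 * w / of_real (1 + (norm w)\<^sup>2), ((norm w)\<^sup>2 - 1) / (1 + (norm w)\<^sup>2))"

fun recip :: "complex option \<Rightarrow> complex option" where
  "recip None = Some 0"
| "recip (Some w) = (if w = 0 then None else Some (1 / w))"

lemma sph_dist_commute: "sph_dist p q = sph_dist q p"
  by (cases p; cases q) (auto simp: norm_minus_commute mult.commute)

lemma one_plus_norm_sq_pos: "1 + (norm w)\<^sup>2 > (0::real)"
  by (simp add: add_pos_nonneg)

text \<open>Makes \<open>sph_dist\<close> a Euclidean chord length, from which the triangle
  inequality and continuity are inherited. Both sides are nonnegative, so squares are
  compared.\<close>

lemma sph_dist_eq_dist_chordal: "sph_dist p q = dist (chordal p) (chordal q)"
proof -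
  have infty: "sph_dist (Some a) None = dist (chordal (Some a)) (chordal None)" for a
  proof -
    define A where "A = 1 + (norm a)\<^sup>2"
    have A: "A > 0" unfolding A_def by (rule one_plus_norm_sq_pos)
    have "(dist (chordal (Some a)) (chordal None))\<^sup>2
        = (norm (2 * a / of_real A))\<^sup>2 + ((A - 2) / A - 1)\<^sup>2"
      by (simp add: dist_prod_def dist_norm A_def algebra_simps)
    also have "norm (2 * a / of_real A) = 2 * norm a / A" using A by (simp add: norm_divide norm_mult)
    also have "(A - 2) / A - 1 = - 2 / A" using A by (simp add: field_simps)
    also have "(2 * norm a / A)\<^sup>2 + (- 2 / A)\<^sup>2 = 4 * (1 + (norm a)\<^sup>2) / A\<^sup>2"
      by (simp add: power_divide power_mult_distrib add_divide_distrib algebra_simps)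
    also have "\<dots> = 4 * A / A\<^sup>2" by (simp add: A_def)
    also have "\<dots> = 4 / A" using A by (simp add: power2_eq_square)
    also have "\<dots> = (sph_dist (Some a) None)\<^sup>2"
      using A by (simp add: A_def power_divide)
    finally have e: "(dist (chordal (Some a)) (chordal None))\<^sup>2 = (sph_dist (Some a) None)\<^sup>2" .
    have "0 \<le> sph_dist (Some a) None" by simp
    then show ?thesis by (rule power2_eq_imp_eq[OF e[symmetric] _ zero_le_dist])
  qed
  have fin: "sph_dist (Some a) (Some b) = dist (chordal (Some a)) (chordal (Some b))" for a b
  proof -
    define A where "A = 1 + (norm a)\<^sup>2"
    define B where "B = 1 + (norm b)\<^sup>2"
    define x y u v where "x = Re a" and "y = Im a" and "u = Re b" and "v = Im b"
    have A: "A > 0" unfolding A_def by (rule one_plus_norm_sq_pos)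
    have B: "B > 0" unfolding B_def by (rule one_plus_norm_sq_pos)
    have Aeq: "x\<^sup>2 + y\<^sup>2 = A - 1" and Beq: "u\<^sup>2 + v\<^sup>2 = B - 1"
      by (simp_all add: A_def B_def x_def y_def u_def v_def cmod_power2)
    have ab: "(norm (a - b))\<^sup>2 = (x - u)\<^sup>2 + (y - v)\<^sup>2"
      by (simp add: cmod_power2 x_def y_def u_def v_def)
    have "(dist (chordal (Some a)) (chordal (Some b)))\<^sup>2
        = (norm (2 * a / of_real A - 2 * b / of_real B))\<^sup>2 + ((A - 2) / A - (B - 2) / B)\<^sup>2"
      by (simp add: dist_prod_def dist_norm A_def B_def algebra_simps)
    also have "2 * a / of_real A - 2 * b / of_real B = (2 / of_real (A * B)) * (of_real B * a - of_real A * b)"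
      using A B by (simp add: field_simps)
    also have "(A - 2) / A - (B - 2) / B = 2 / (A * B) * (A - B)"
      using A B by (simp add: field_simps)
    also have "(norm (2 / of_real (A * B) * (of_real B * a - of_real A * b)))\<^sup>2
        = (norm (2 / of_real (A * B) :: complex))\<^sup>2 * (norm (of_real B * a - of_real A * b))\<^sup>2"
      by (simp only: norm_mult power_mult_distrib)
    also have "(norm (of_real B * a - of_real A * b))\<^sup>2 = (B * x - A * u)\<^sup>2 + (B * y - A * v)\<^sup>2"
      by (simp add: cmod_power2 x_def y_def u_def v_def)
    also have "norm (2 / of_real (A * B) :: complex) = 2 / (A * B)"
      using A B by (simp add: norm_divide norm_mult)
    also have "(2 / (A * B))\<^sup>2 * ((B * x - A * u)\<^sup>2 + (B * y - A * v)\<^sup>2) + (2 / (A * B) * (A - B))\<^sup>2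
        = (2 / (A * B))\<^sup>2 * ((B * x - A * u)\<^sup>2 + (B * y - A * v)\<^sup>2 + (A - B)\<^sup>2)"
      by (simp only: power_mult_distrib distrib_left)
    \<comment> \<open>With \<open>norm a\<close> and \<open>norm b\<close> eliminated in favour of
      \<open>A\<close> and \<open>B\<close>, both sides are
      \<open>A * B * (A + B - 2 - 2 * (x * u + y * v))\<close>.\<close>
    also have "(B * x - A * u)\<^sup>2 + (B * y - A * v)\<^sup>2 + (A - B)\<^sup>2 = A * B * ((x - u)\<^sup>2 + (y - v)\<^sup>2)"
      using Aeq Beq by algebra
    also have "(2 / (A * B))\<^sup>2 * (A * B * ((x - u)\<^sup>2 + (y - v)\<^sup>2)) = 4 * (norm (a - b))\<^sup>2 / (A * B)"
      using A B unfolding ab by (simp add: power2_eq_square divide_simps)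
    also have "\<dots> = (sph_dist (Some a) (Some b))\<^sup>2"
      using A B by (simp add: A_def B_def power_divide power_mult_distrib)
    finally have e: "(dist (chordal (Some a)) (chordal (Some b)))\<^sup>2 = (sph_dist (Some a) (Some b))\<^sup>2" .
    have "0 \<le> sph_dist (Some a) (Some b)" by simp
    then show ?thesis by (rule power2_eq_imp_eq[OF e[symmetric] _ zero_le_dist])
  qed
  show ?thesis
    by (cases p; cases q) (simp_all only: infty fin sph_dist_commute[of None "Some _"] dist_commute[of "chordal None" "chordal (Some _)"], simp)
qed

lemma sph_dist_triangle: "sph_dist p r \<le> sph_dist p q + sph_dist q r"
  unfolding sph_dist_eq_dist_chordal by (rule dist_triangle)

text \<open>On the sphere, inversion is a rotation by the angle \<pi>. Hence \<open>f\<close> and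
  \<open>recip \<circ> f\<close> share their almost periods and their modulus of continuity.\<close>

lemma sph_dist_recip: "sph_dist (recip p) (recip q) = sph_dist p q"
proof -
  have s: "sqrt (1 + (norm (1 / a))\<^sup>2) = sqrt (1 + (norm a)\<^sup>2) / norm a" if "a \<noteq> 0" for a :: complex
  proof -
    have "1 + (norm (1 / a))\<^sup>2 = (1 + (norm a)\<^sup>2) / (norm a)\<^sup>2"
      using that by (simp add: norm_divide power_divide field_simps)
    then show ?thesis by (simp add: real_sqrt_divide)
  qed
  have sne: "sqrt (1 + (norm a)\<^sup>2) \<noteq> 0" for a :: complex
    using one_plus_norm_sq_pos[of a] by simp
  have 1: "sph_dist (recip (Some a)) (recip (Some b)) = sph_dist (Some a) (Some b)" for a b
  proof (cases "a = 0 \<or> b = 0")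
    case True
    then show ?thesis using s[of a] s[of b] by auto
  next
    case False
    then have "1 / a - 1 / b = (b - a) / (a * b)" by (simp add: field_simps)
    then have "norm (1 / a - 1 / b) = norm (a - b) / (norm a * norm b)"
      by (simp add: norm_divide norm_mult norm_minus_commute)
    then show ?thesis using False s[of a] s[of b] sne[of a] sne[of b]
      by (simp add: real_sqrt_mult)
  qed
  have 2: "sph_dist (recip (Some a)) (recip None) = sph_dist (Some a) None" for a
    using s[of a] sne[of a] by (cases "a = 0") (simp_all add: norm_divide)
  have 3: "sph_dist (recip None) (recip (Some a)) = sph_dist None (Some a)" for a
    using 2[of a] sph_dist_commute[of "recip None"] sph_dist_commute[of None] by metis
  have 4: "sph_dist (recip None) (recip None) = sph_dist None None" by simp
  show ?thesis by (cases p; cases q) (simp_all only: 1 2 3 4)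
qed

text \<open>Converts spherical into Euclidean closeness near a bounded value. The condition
  \<open>\<epsilon> * (1 + B) \<le> 1\<close> excludes infinity and lets the unknown distance on the
  right be absorbed: \<open>2 * t < \<epsilon> * (1 + B)\<^sup>2 + t\<close>.\<close>

lemma sph_dist_close:
  assumes a: "norm a \<le> B" and eps: "\<epsilon> * (1 + B) \<le> 1" "\<epsilon> > 0" and d: "sph_dist p (Some a) < \<epsilon>"
  obtains b where "p = Some b" "norm (b - a) \<le> \<epsilon> * (1 + B)\<^sup>2"
proof -
  have s: "sqrt (1 + (norm w)\<^sup>2) \<le> 1 + norm w" for w :: complex
    by (rule real_le_lsqrt) (auto simp: power2_eq_square algebra_simps)
  have B: "1 + B > 0" using a norm_ge_zero[of a] by linarith
  have sp: "sqrt (1 + (norm w)\<^sup>2) > 0" for w :: complex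
    using one_plus_norm_sq_pos[of w] by simp
  show ?thesis
  proof (cases p)
    case None
    then have "2 < \<epsilon> * sqrt (1 + (norm a)\<^sup>2)" using d sp[of a] by (simp add: field_simps)
    also have "\<dots> \<le> \<epsilon> * (1 + B)" using s[of a] a eps(2) by (intro mult_left_mono) auto
    finally show ?thesis using eps by simp
  next
    case (Some b)
    define t where "t = norm (b - a)"
    have "norm b \<le> norm a + t" unfolding t_def by (metis add.commute diff_add_cancel norm_triangle_ineq)
    then have nb: "1 + norm b \<le> 1 + B + t" using a by linarith
    have "2 * t < \<epsilon> * (sqrt (1 + (norm b)\<^sup>2) * sqrt (1 + (norm a)\<^sup>2))"
    proof -
      have "2 * t / (sqrt (1 + (norm b)\<^sup>2) * sqrt (1 + (norm a)\<^sup>2)) < \<epsilon>"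
        using d unfolding Some t_def by (simp add: real_sqrt_mult)
      then show ?thesis using sp[of a] sp[of b] by (subst (asm) pos_divide_less_eq) auto
    qed
    also have "\<dots> \<le> \<epsilon> * ((1 + B + t) * (1 + B))"
      using s[of a] s[of b] a nb sp[of a] sp[of b] eps(2) B
      by (intro mult_left_mono mult_mono order_trans[OF s nb] order_trans[OF s]) (auto simp: t_def)
    also have "\<dots> = \<epsilon> * (1 + B)\<^sup>2 + (\<epsilon> * (1 + B)) * t" by (simp add: power2_eq_square algebra_simps)
    also have "\<dots> \<le> \<epsilon> * (1 + B)\<^sup>2 + 1 * t"
      using eps(1) by (intro add_left_mono mult_right_mono) (auto simp: t_def)
    finally show ?thesis using that[OF Some] by (simp add: t_def)
  qed
qed

subsection \<open>Nonconstant meromorphic functions\<close>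

locale nonconst_mero =
  fixes f :: "complex \<Rightarrow> complex option"
  assumes mero: "meromorphic_C f" and nonconst: "\<not> (\<exists>c. \<forall>z. f z = c)"
begin

definition zeros :: "complex set" where "zeros = {z. f z = Some 0}"

lemma no_limpt_poles: "\<not> z islimpt pole_set f"
  and holo: "(\<lambda>z. the (f z)) holomorphic_on (- pole_set f)"
  and at_pole: "p \<in> pole_set f \<Longrightarrow> filterlim (\<lambda>z. the (f z)) at_infinity (at p)"
  using mero by (auto simp: meromorphic_C_def)

lemma eventually_ge_1_at_pole:
  assumes "p \<in> pole_set f"
  shows "\<forall>\<^sub>F w in at p. norm (the (f w)) \<ge> 1"
proof -
  have "\<forall>r>0. \<forall>\<^sub>F w in at p. r \<le> norm (the (f w))"
    using at_pole[OF assms] filterlim_at_infinity[of 0 "\<lambda>z. the (f z)" "at p"] by simp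
  then show ?thesis by simp
qed

lemma open_compl_poles: "open (- pole_set f)"
  using no_limpt_poles closed_limpt by blast

lemma connected_compl_poles: "connected (- pole_set f)"
  unfolding Compl_eq_Diff_UNIV
  by (rule connected_open_diff_countable) (auto intro: no_limpt_imp_countable[OF no_limpt_poles])

lemma eventually_not_pole: "\<forall>\<^sub>F w in at z. w \<notin> pole_set f"
  using no_limpt_poles by (simp add: islimpt_iff_eventually)

lemma not_pole: "z \<notin> pole_set f \<Longrightarrow> f z = Some (the (f z))"
  by (auto simp: pole_set_def)

lemma the_eq_0_iff: "z \<notin> pole_set f \<Longrightarrow> the (f z) = 0 \<longleftrightarrow> z \<in> zeros"
  by (auto simp: pole_set_def zeros_def)

lemma zeros_disjoint: "z \<in> zeros \<Longrightarrow> z \<notin> pole_set f"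
  by (auto simp: zeros_def pole_set_def)

lemma isCont_off_poles: "z \<notin> pole_set f \<Longrightarrow> isCont (\<lambda>z. the (f z)) z"
  using holomorphic_on_imp_continuous_on[OF holo] open_compl_poles continuous_on_eq_continuous_at by blast

text \<open>Near a pole the values are large. Elsewhere the identity theorem applies on the
  complement of the poles, which is connected because the poles are countable.\<close>

lemma no_limpt_zeros: "\<not> z islimpt zeros"
proof
  assume lim: "z islimpt zeros"
  have hit: "\<exists>\<^sub>F w in at z. w \<in> zeros" using lim by (simp add: islimpt_iff_eventually frequently_def)
  show False
  proof (cases "z \<in> pole_set f")
    case True
    have "\<forall>\<^sub>F w in at z. norm (the (f w)) \<ge> 1" by (rule eventually_ge_1_at_pole[OF True])
    then have "\<forall>\<^sub>F w in at z. w \<notin> zeros" by eventually_elim (auto simp: zeros_def)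
    then show False using hit by (simp add: frequently_def)
  next
    case False
    have zero: "the (f w) = 0" if "w \<notin> pole_set f" for w
      by (rule analytic_continuation[OF holo open_compl_poles connected_compl_poles, of zeros z])
         (use lim False that zeros_disjoint in \<open>auto simp: zeros_def\<close>)
    \<comment> \<open>Vanishing off the poles is incompatible with a pole, near which the modulus is
      at least 1; so \<open>f\<close> would be constant as a map into the sphere.\<close>
    have "pole_set f = {}"
    proof (rule ccontr)
      assume "pole_set f \<noteq> {}"
      then obtain p where p: "p \<in> pole_set f" by blast
      from eventually_ge_1_at_pole[OF p] eventually_not_pole[of p] have "\<forall>\<^sub>F w in at p. False"
        by eventually_elim (use zero in force)
      then show False by simp
    qed
    then have "f w = Some 0" for w
      using zero[of w] the_eq_0_iff[of w] by (simp add: zeros_def)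
    then show False using nonconst by blast
  qed
qed

lemma eventually_not_zero: "\<forall>\<^sub>F w in at z. w \<notin> zeros"
  using no_limpt_zeros by (simp add: islimpt_iff_eventually)

lemma pole_set_recip: "pole_set (recip \<circ> f) = zeros"
proof -
  have "recip p = None \<longleftrightarrow> p = Some 0" for p by (cases p) auto
  then show ?thesis by (auto simp: pole_set_def zeros_def)
qed

lemma recip_eq_inverse: "z \<notin> pole_set f \<Longrightarrow> z \<notin> zeros \<Longrightarrow> recip (f z) = Some (inverse (the (f z)))"
  by (auto simp: pole_set_def zeros_def inverse_eq_divide)

lemma open_good: "open (- (zeros \<union> pole_set f))"
proof -
  have "closed zeros" "closed (pole_set f)"
    using no_limpt_zeros no_limpt_poles closed_limpt by blast+
  then show ?thesis using open_Compl[OF closed_Un] by blast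
qed

lemma meromorphic_recip: "meromorphic_C (recip \<circ> f)"
proof -
  define G where "G = (\<lambda>z. the (recip (f z)))"
  have G: "G z = inverse (the (f z))" if "z \<notin> pole_set f" "z \<notin> zeros" for z
    using recip_eq_inverse[OF that] by (simp add: G_def)
  have hol_good: "G holomorphic_on (- (zeros \<union> pole_set f))"
  proof (rule holomorphic_transform)
    show "(\<lambda>z. inverse (the (f z))) holomorphic_on (- (zeros \<union> pole_set f))"
      by (intro holomorphic_intros holomorphic_on_subset[OF holo])
         (auto simp: the_eq_0_iff)
  qed (use G in auto)
  have "G field_differentiable at z" if z: "z \<notin> zeros" for z
  proof (cases "z \<in> pole_set f")
    case False
    then show ?thesis using hol_good open_good z holomorphic_on_imp_differentiable_at by blast
  next
    case True
    have "\<forall>\<^sub>F w in at z. w \<notin> zeros \<and> w \<notin> pole_set f"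
      using eventually_not_pole[of z] eventually_not_zero[of z] by eventually_elim auto
    then obtain r where r: "r > 0" "\<And>w. w \<in> ball z r - {z} \<Longrightarrow> w \<notin> zeros \<and> w \<notin> pole_set f"
      by (auto simp: eventually_at dist_commute)
    have "((\<lambda>w. inverse (the (f w))) \<longlongrightarrow> 0) (at z)"
      using at_pole[OF True] tendsto_inverse_0 filterlim_compose by blast
    moreover have "\<forall>\<^sub>F w in at z. inverse (the (f w)) = G w"
      using eventually_not_pole[of z] eventually_not_zero[of z] by eventually_elim (use G in auto)
    moreover have "G z = 0" using True by (simp add: G_def pole_set_def)
    ultimately have lim: "(G \<longlongrightarrow> G z) (at z)" using Lim_transform_eventually by fastforce
    \<comment> \<open>At a pole of \<open>f\<close> the value of \<open>G\<close> is 0, which is the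
      limit of \<open>1 / f\<close>, so the singularity is removable.\<close>
    have "G holomorphic_on ball z r"
    proof (rule no_isolated_singularity'[of "{z}"])
      show "G holomorphic_on ball z r - {z}" by (rule holomorphic_on_subset[OF hol_good]) (use r in auto)
    qed (use lim in \<open>auto intro: tendsto_within_subset\<close>)
    then show ?thesis using r(1) holomorphic_on_imp_differentiable_at by (metis centre_in_ball open_ball)
  qed
  then have hol: "G holomorphic_on - zeros"
    by (auto simp: holomorphic_on_def intro: field_differentiable_at_within)
  have pole: "filterlim G at_infinity (at z)" if z: "z \<in> zeros" for z
  proof -
    have "(\<lambda>w. the (f w)) \<midarrow>z\<rightarrow> 0"
      using isCont_off_poles[OF zeros_disjoint[OF z]] z by (simp add: isCont_def zeros_def)
    moreover have "\<forall>\<^sub>F w in at z. the (f w) \<noteq> 0"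
      using eventually_not_pole[of z] eventually_not_zero[of z]
      by eventually_elim (auto simp: the_eq_0_iff)
    ultimately have "filterlim (\<lambda>w. the (f w)) (at 0) (at z)" by (rule filterlim_atI)
    then have "filterlim (\<lambda>w. inverse (the (f w))) at_infinity (at z)"
      using filterlim_inverse_at_infinity filterlim_compose by blast
    moreover have "\<forall>\<^sub>F w in at z. inverse (the (f w)) = G w"
      using eventually_not_pole[of z] eventually_not_zero[of z] by eventually_elim (use G in auto)
    ultimately show ?thesis by (rule filterlim_cong[OF refl refl, THEN iffD1, rotated])
  qed
  show ?thesis
    unfolding meromorphic_C_def pole_set_recip
    using no_limpt_zeros hol pole by (simp add: G_def)
qed

text \<open>At a pole the chord to infinity has length
  \<open>2 / sqrt (1 + (norm a)\<^sup>2)\<close>, hence at most twice the modulus of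
  \<open>1 / f\<close>.\<close>

lemma isCont_chordal: "isCont (\<lambda>z. chordal (f z)) z"
proof (cases "z \<in> pole_set f")
  case False
  define c where "c = (\<lambda>w::complex. chordal (Some w))"
  have "isCont c w" for w
    unfolding c_def chordal.simps
    using one_plus_norm_sq_pos[of w]
    by (intro continuous_intros) (auto simp del: of_real_add)
  then have "isCont (\<lambda>w. c (the (f w))) z"
    using isCont_off_poles[OF False] isCont_o2 by blast
  moreover have "\<forall>\<^sub>F w in nhds z. c (the (f w)) = chordal (f w)"
    using eventually_nhds_in_open[OF open_compl_poles, of z] False
    by (auto elim!: eventually_mono simp: c_def pole_set_def)
  ultimately show ?thesis using isCont_cong by fast
next
  case True
  have "((\<lambda>w. dist (chordal (f w)) (chordal (f z))) \<longlongrightarrow> 0) (at z)"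
  proof (rule Lim_null_comparison)
    have "((\<lambda>w. inverse (the (f w))) \<longlongrightarrow> 0) (at z)"
      using at_pole[OF True] tendsto_inverse_0 filterlim_compose by blast
    then have "((\<lambda>w. 2 * norm (inverse (the (f w)))) \<longlongrightarrow> 2 * norm (0::complex)) (at z)"
      by (intro tendsto_intros)
    then show "((\<lambda>w. 2 * norm (inverse (the (f w)))) \<longlongrightarrow> 0) (at z)" by simp
    show "\<forall>\<^sub>F w in at z. norm (dist (chordal (f w)) (chordal (f z))) \<le> 2 * norm (inverse (the (f w)))"
      using eventually_not_pole[of z] eventually_not_zero[of z]
    proof eventually_elim
      case (elim w)
      define a where "a = the (f w)"
      have fw: "f w = Some a" using elim by (auto simp: a_def pole_set_def)
      have a: "a \<noteq> 0" using elim the_eq_0_iff[of w] by (simp add: a_def)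
      have "norm a \<le> sqrt (1 + (norm a)\<^sup>2)" by (rule real_le_rsqrt) simp
      then have "2 / sqrt (1 + (norm a)\<^sup>2) \<le> 2 / norm a"
        using a by (intro divide_left_mono) (auto simp: one_plus_norm_sq_pos)
      moreover have "f z = None" using True by (simp add: pole_set_def)
      then have "dist (chordal (f w)) (chordal (f z)) = 2 / sqrt (1 + (norm a)\<^sup>2)"
        unfolding sph_dist_eq_dist_chordal[symmetric] fw by simp
      ultimately show ?case
        by (simp add: a_def norm_inverse divide_inverse)
    qed
  qed
  then show ?thesis unfolding isCont_def by (rule tendsto_dist_iff[THEN iffD2])
qed

end

subsection \<open>Almost elliptic functions\<close>

definition log_deriv :: "(complex \<Rightarrow> complex option) \<Rightarrow> complex \<Rightarrow> complex" where
  "log_deriv f z = deriv (\<lambda>w. the (f w)) z / the (f z)"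

lemma recip_recip [simp]: "recip (recip p) = p"
  by (cases p) auto

context nonconst_mero
begin

lemma log_deriv_recip:
  assumes z: "z \<notin> zeros \<union> pole_set f"
  shows "log_deriv (recip \<circ> f) z = - log_deriv f z"
proof -
  have z': "z \<in> - (zeros \<union> pole_set f)" "z \<notin> pole_set f" "z \<notin> zeros" using z by auto
  then have ne: "the (f z) \<noteq> 0" using the_eq_0_iff by blast
  have d: "((\<lambda>w. the (f w)) has_field_derivative deriv (\<lambda>w. the (f w)) z) (at z)"
    using holo open_compl_poles z' by (intro holomorphic_derivI) auto
  have "((\<lambda>w. the ((recip \<circ> f) w)) has_field_derivative
      - (inverse (the (f z)) * deriv (\<lambda>w. the (f w)) z * inverse (the (f z)))) (at z)"
    by (rule has_field_derivative_transform_within_open[OF DERIV_inverse'[OF d ne] open_good z'(1)])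
       (simp add: recip_eq_inverse)
  then have "deriv (\<lambda>w. the ((recip \<circ> f) w)) z
      = - (inverse (the (f z)) * deriv (\<lambda>w. the (f w)) z * inverse (the (f z)))"
    by (rule DERIV_imp_deriv)
  then show ?thesis using ne z' by (simp add: log_deriv_def recip_eq_inverse field_simps)
qed

text \<open>The constant 1/4 is chosen for \<open>sph_dist_close\<close> with \<open>B = 1\<close>:
  there \<open>1 / 4 * (1 + 1)\<^sup>2 = 1\<close>, so a value of modulus at most 1 moves by at most
  1.\<close>

lemma chart:
  assumes unif: "\<And>z w. dist z w < \<delta> \<Longrightarrow> sph_dist (f z) (f w) < 1 / 4"
    and c: "c \<notin> pole_set f" "norm (the (f c)) \<le> 1" and z: "z \<in> ball c \<delta>"
  shows "z \<notin> pole_set f" "norm (the (f z)) \<le> 2"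
proof -
  have "sph_dist (f z) (Some (the (f c))) < 1 / 4"
    using unif[of z c] z not_pole[OF c(1)] by (simp add: dist_commute)
  then obtain b where b: "f z = Some b" "norm (b - the (f c)) \<le> 1 / 4 * (1 + 1)\<^sup>2"
    by (rule sph_dist_close[OF c(2), rotated 2]) auto
  have "norm b \<le> norm (b - the (f c)) + norm (the (f c))"
    using norm_triangle_ineq[of "b - the (f c)" "the (f c)"] by simp
  then show "z \<notin> pole_set f" "norm (the (f z)) \<le> 2" using b c(2) by (auto simp: pole_set_def)
qed

lemma finite_zeros_poles_bounded:
  assumes "bounded S" shows "finite (S \<inter> (zeros \<union> pole_set f))"
proof -
  have "\<not> z islimpt (zeros \<union> pole_set f)" for z
    using no_limpt_zeros no_limpt_poles by (simp add: islimpt_Un)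
  then have "finite (closure S \<inter> (zeros \<union> pole_set f))"
    using assms by (intro finite_not_islimpt_in_compact) (auto simp: compact_closure)
  then show ?thesis by (rule rev_finite_subset) (use closure_subset in auto)
qed

end

section \<open>Uniform estimates and relative density of zeros from almost periodicity\<close>

locale almost_elliptic_fun =
  fixes f :: "complex \<Rightarrow> complex option"
  assumes almost_elliptic: "almost_elliptic f"

sublocale almost_elliptic_fun \<subseteq> nonconst_mero
  using almost_elliptic by unfold_locales (auto simp: almost_elliptic_def)

context almost_elliptic_fun
begin

lemma almost_periods:
  assumes "\<epsilon> > 0"
  obtains L :: real where "L > 0"
    "\<And>c. \<exists>\<tau>\<in>cball c L. \<forall>z. sph_dist (f (z + \<tau>)) (f z) < \<epsilon>"
proof -
  obtain L :: real where L: "\<And>c. \<exists>\<tau>\<in>cball c L. \<forall>z. sph_dist (f (z + \<tau>)) (f z) < \<epsilon>"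
    using almost_elliptic assms unfolding almost_elliptic_def by meson
  have "\<exists>\<tau>\<in>cball c (max L 1). \<forall>z. sph_dist (f (z + \<tau>)) (f z) < \<epsilon>" for c
    using L[of c] by (meson max.cobounded1 subset_cball subsetD)
  then show ?thesis by (intro that[of "max L 1"]) auto
qed

lemma almost_elliptic_recip: "almost_elliptic (recip \<circ> f)"
proof -
  have "\<not> (\<exists>c. \<forall>z. (recip \<circ> f) z = c)"
  proof
    assume "\<exists>c. \<forall>z. (recip \<circ> f) z = c"
    then obtain c where c: "recip (f z) = c" for z by auto
    have "f z = recip c" for z using recip_recip[of "f z"] c[of z] by simp
    then show False using nonconst by blast
  qed
  then show ?thesis
    using meromorphic_recip almost_elliptic unfolding almost_elliptic_def by (simp add: sph_dist_recip)
qed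

text \<open>An almost period moves any pair of nearby points back to a fixed compact disc; the two
  translations and the continuity there each cost 1/12. Points at distance below 1 land in the disc
  of radius \<open>L + 1\<close>.\<close>

lemma spherically_uniformly_continuous:
  obtains \<delta> where "\<delta> > 0" "\<And>z w. dist z w < \<delta> \<Longrightarrow> sph_dist (f z) (f w) < 1 / 4"
proof -
  obtain L where L: "L > 0" "\<And>c. \<exists>\<tau>\<in>cball c L. \<forall>z. sph_dist (f (z + \<tau>)) (f z) < 1/12"
    using almost_periods[of "1/12"] by auto
  have "uniformly_continuous_on (cball 0 (L + 1)) (\<lambda>z. chordal (f z))"
    by (intro compact_uniformly_continuous continuous_at_imp_continuous_on)
       (simp_all add: isCont_chordal)
  then obtain d where d: "d > 0" "\<And>z w. \<lbrakk>z \<in> cball 0 (L+1); w \<in> cball 0 (L+1); dist w z < d\<rbrakk>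
      \<Longrightarrow> sph_dist (f w) (f z) < 1/12"
    unfolding uniformly_continuous_on_def sph_dist_eq_dist_chordal
    by (metis divide_pos_pos zero_less_numeral zero_less_one)
  show ?thesis
  proof (rule that[of "min d 1"])
    fix z w :: complex assume zw: "dist z w < min d 1"
    obtain \<tau> where \<tau>: "\<tau> \<in> cball z L" "\<And>z. sph_dist (f (z + \<tau>)) (f z) < 1/12" using L(2) by blast
    have z': "z - \<tau> \<in> cball 0 (L+1)" using \<tau>(1) by (simp add: dist_norm norm_minus_commute)
    have "norm (w - \<tau>) \<le> norm (z - \<tau>) + norm (w - z)"
      using norm_triangle_ineq[of "z - \<tau>" "w - z"] by simp
    then have w': "w - \<tau> \<in> cball 0 (L+1)" using \<tau>(1) zw by (simp add: dist_norm norm_minus_commute)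
    have "sph_dist (f (w - \<tau>)) (f (z - \<tau>)) < 1/12"
      using zw by (intro d(2) z' w') (simp add: dist_norm norm_minus_commute)
    moreover have "sph_dist (f w) (f (w - \<tau>)) < 1/12" "sph_dist (f z) (f (z - \<tau>)) < 1/12"
      using \<tau>(2)[of "w - \<tau>"] \<tau>(2)[of "z - \<tau>"] by simp_all
    ultimately show "sph_dist (f z) (f w) < 1/4"
      using sph_dist_triangle[of "f z" "f w" "f (z - \<tau>)"] sph_dist_triangle[of "f (z - \<tau>)" "f w" "f (w - \<tau>)"]
        sph_dist_commute[of "f w" "f (w - \<tau>)"] sph_dist_commute[of "f (w - \<tau>)" "f (z - \<tau>)"]
      by linarith
  qed (use d in auto)
qed

lemma relatively_dense_nonsmall:
  obtains L c0 where "L > 0" "c0 > 0"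
    "\<And>c. \<exists>z\<in>cball c L. z \<notin> pole_set f \<and> c0 \<le> norm (the (f z))"
proof -
  have "\<forall>\<^sub>F w in at 0. w \<notin> pole_set f \<and> w \<notin> zeros"
    using eventually_not_pole[of 0] eventually_not_zero[of 0] by eventually_elim auto
  then obtain w0 where w0: "w0 \<notin> pole_set f" "w0 \<notin> zeros"
    using eventually_happens[of _ "at (0::complex)"] by auto
  define a where "a = the (f w0)"
  have a: "a \<noteq> 0" "f w0 = Some a" using w0 the_eq_0_iff not_pole by (auto simp: a_def)
  \<comment> \<open>Makes the error in \<open>sph_dist_close\<close> equal to
    \<open>norm a / 2\<close>, so that translates of \<open>w0\<close> keep half of the modulus of
    \<open>a\<close>.\<close>
  define \<epsilon> where "\<epsilon> = norm a / (2 * (1 + norm a)\<^sup>2)"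
  have na: "1 + norm a > 0" by (simp add: add_pos_nonneg)
  have \<epsilon>: "\<epsilon> > 0" using a na by (simp add: \<epsilon>_def)
  have e2: "\<epsilon> * (1 + norm a)\<^sup>2 = norm a / 2" using na by (simp add: \<epsilon>_def)
  have e1: "\<epsilon> * (1 + norm a) \<le> 1"
  proof -
    have "\<epsilon> * (1 + norm a) = norm a / (2 * (1 + norm a))"
      using na by (simp add: \<epsilon>_def power2_eq_square)
    also have "\<dots> \<le> 1" using na by (simp add: divide_simps)
    finally show ?thesis .
  qed
  obtain L where L: "L > 0" "\<And>c. \<exists>\<tau>\<in>cball c L. \<forall>z. sph_dist (f (z + \<tau>)) (f z) < \<epsilon>"
    using almost_periods[OF \<epsilon>] by auto
  show ?thesis
  proof (rule that[of L "norm a / 2"])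
    fix c
    obtain \<tau> where \<tau>: "\<tau> \<in> cball (c - w0) L" "sph_dist (f (w0 + \<tau>)) (f w0) < \<epsilon>" using L(2) by blast
    obtain b where b: "f (w0 + \<tau>) = Some b" "norm (b - a) \<le> \<epsilon> * (1 + norm a)\<^sup>2"
      using sph_dist_close[OF order_refl e1 \<epsilon>] \<tau>(2) a(2) by metis
    have "norm a \<le> norm b + norm (b - a)" using norm_triangle_ineq4[of b "b - a"] by simp
    then have "norm a / 2 \<le> norm b" using b(2) e2 by simp
    moreover have "w0 + \<tau> \<in> cball c L" using \<tau>(1) by (simp add: dist_norm algebra_simps)
    ultimately show "\<exists>z\<in>cball c L. z \<notin> pole_set f \<and> norm a / 2 \<le> norm (the (f z))"
      using b(1) by (intro bexI[of _ "w0 + \<tau>"]) (auto simp: pole_set_def)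
  qed (use L a in auto)
qed

text \<open>Extreme smallness on one disc would spread along a chain of overlapping discs. Boundedly
  many links reach a point where the modulus is at least \<open>c0\<close>, so the threshold is
  independent of the disc.\<close>

lemma not_uniformly_small_on_balls:
  assumes "r > 0"
  obtains \<eta> where "\<eta> > 0" "\<And>c. \<exists>z\<in>ball c r. z \<in> pole_set f \<or> \<eta> \<le> norm (the (f z))"
proof -
  obtain \<delta> where \<delta>: "\<delta> > 0" and unif: "\<And>z w. dist z w < \<delta> \<Longrightarrow> sph_dist (f z) (f w) < 1 / 4"
    using spherically_uniformly_continuous by metis
  \<comment> \<open>The disc of radius \<open>4 * s\<close> has to lie in a single chart.\<close>
  define s where "s = min r (\<delta> / 4)"
  have s: "s > 0" "s \<le> r" "4 * s \<le> \<delta>" using assms \<delta> by (auto simp: s_def)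
  define small where "small = (\<lambda>\<eta> c. \<forall>z\<in>ball c s. z \<notin> pole_set f \<and> norm (the (f z)) < \<eta>)"
  obtain L c0 where L: "L > 0" "c0 > 0"
    and big: "\<And>c. \<exists>z\<in>cball c L. z \<notin> pole_set f \<and> c0 \<le> norm (the (f z))"
    using relatively_dense_nonsmall by metis
  have step: "\<exists>\<eta>>0. \<forall>c d. small \<eta> c \<longrightarrow> norm d < s \<longrightarrow> small \<omega> (c + d)" if \<omega>: "\<omega> > 0" for \<omega>
  proof -
    obtain \<eta> where \<eta>: "\<eta> > 0" and propagate: "\<And>F c z. \<lbrakk>F holomorphic_on ball c (4 * s); \<And>z. z \<in> ball c (4 * s) \<Longrightarrow> norm (F z) \<le> 2;
       \<And>z. z \<in> ball c s \<Longrightarrow> norm (F z) < \<eta>; z \<in> cball c (2 * s)\<rbrakk> \<Longrightarrow> norm (F z) < \<omega>"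
      using small_propagates[OF s(1) \<omega>] by metis
    \<comment> \<open>The minimum with 1 ensures that \<open>f\<close> is in its finite chart at
      \<open>c\<close>.\<close>
    have "small \<omega> (c + d)" if sm: "small (min \<eta> 1) c" and d: "norm d < s" for c d
    proof -
      have "c \<in> ball c s" using s(1) by simp
      then have "c \<notin> pole_set f \<and> norm (the (f c)) < min \<eta> 1" using sm unfolding small_def by blast
      then have c: "c \<notin> pole_set f" "norm (the (f c)) \<le> 1" by auto
      have sub: "ball c (4 * s) \<subseteq> ball c \<delta>" using s(3) by (rule subset_ball)
      note ch = chart[of \<delta>, OF unif c, OF _ subsetD[OF sub]]
      have "norm (the (f z)) < \<omega>" if "z \<in> cball c (2 * s)" for z
      proof (rule propagate[of "\<lambda>z. the (f z)" c])
        show "(\<lambda>z. the (f z)) holomorphic_on ball c (4 * s)"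
          by (rule holomorphic_on_subset[OF holo]) (use ch in blast)
      qed (use ch sm that in \<open>auto simp: small_def\<close>)
      moreover have "ball (c + d) s \<subseteq> cball c (2 * s)"
      proof
        fix z assume "z \<in> ball (c + d) s"
        then have "norm (z - (c + d)) < s" by (simp add: dist_norm norm_minus_commute)
        moreover have "norm (z - c) \<le> norm (z - (c + d)) + norm d"
          using norm_triangle_ineq[of "z - (c + d)" d] by (simp add: algebra_simps)
        ultimately show "z \<in> cball c (2 * s)" using d by (simp add: dist_norm norm_minus_commute)
      qed
      moreover have "cball c (2 * s) \<subseteq> ball c (4 * s)" using s(1) by auto
      ultimately show ?thesis unfolding small_def using ch by blast
    qed
    then show ?thesis using \<eta> by (intro exI[of _ "min \<eta> 1"]) auto
  qed
  \<comment> \<open>Thresholds are chosen backwards from the last link, hence uniformly in the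
    starting point and the direction.\<close>
  have chain: "\<exists>\<eta>>0. \<forall>c d. small \<eta> c \<longrightarrow> norm d < s \<longrightarrow> small \<omega> (c + of_nat n * d)" if "\<omega> > 0" for n \<omega>
    using that
  proof (induction n arbitrary: \<omega>)
    case 0
    then show ?case by (intro exI[of _ \<omega>]) auto
  next
    case (Suc n)
    obtain \<eta>1 where 1: "\<eta>1 > 0" "\<And>c d. small \<eta>1 c \<Longrightarrow> norm d < s \<Longrightarrow> small \<omega> (c + d)"
      using step[OF Suc.prems] by blast
    obtain \<eta> where 2: "\<eta> > 0" "\<And>c d. small \<eta> c \<Longrightarrow> norm d < s \<Longrightarrow> small \<eta>1 (c + of_nat n * d)"
      using Suc.IH[OF 1(1)] by blast
    have "small \<omega> (c + of_nat (Suc n) * d)" if "small \<eta> c" "norm d < s" for c d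
      using 1(2)[OF 2(2)[OF that] that(2)] by (simp add: algebra_simps)
    then show ?case using 2(1) by blast
  qed
  obtain n :: nat where n: "L / s < real n" using reals_Archimedean2 by blast
  have n0: "real n > 0" using n L(1) s(1) by (meson divide_pos_pos order_less_trans)
  obtain \<eta> where \<eta>: "\<eta> > 0" "\<And>c d. small \<eta> c \<Longrightarrow> norm d < s \<Longrightarrow> small c0 (c + of_nat n * d)"
    using chain[OF L(2)] by blast
  have notsmall: "\<not> small \<eta> c" for c
  proof
    assume sm: "small \<eta> c"
    obtain z where z: "z \<in> cball c L" "c0 \<le> norm (the (f z))" using big by blast
    define d where "d = (z - c) / of_nat n"
    have "norm d \<le> L / real n" using z(1) n0 by (simp add: d_def norm_divide dist_norm norm_minus_commute divide_right_mono)
    also have "\<dots> < s" using n n0 s(1) by (simp add: field_simps)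
    finally have "small c0 (c + of_nat n * d)" using \<eta>(2) sm by blast
    moreover have "c + of_nat n * d = z" using n0 by (simp add: d_def)
    ultimately have "small c0 z" by simp
    moreover have "z \<in> ball z s" using s(1) by simp
    ultimately have "norm (the (f z)) < c0" unfolding small_def by blast
    then show False using z(2) by simp
  qed
  show ?thesis
  proof (rule that[OF \<eta>(1)])
    fix c
    obtain z where z: "z \<in> ball c s" "\<not> (z \<notin> pole_set f \<and> norm (the (f z)) < \<eta>)"
      using notsmall[of c] unfolding small_def by blast
    then have "z \<in> ball c r" using subset_ball[OF s(2)] by blast
    then show "\<exists>z\<in>ball c r. z \<in> pole_set f \<or> \<eta> \<le> norm (the (f z))" using z(2) by (intro bexI[of _ z]) auto
  qed
qed

text \<open>Without zeros, the oscillation bound for a logarithm of \<open>f\<close> keeps the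
  modulus away from 0; then \<open>1 / f\<close> is bounded and entire, hence constant by
  Liouville.\<close>

lemma zeros_nonempty: "zeros \<noteq> {}"
proof
  assume none: "zeros = {}"
  obtain \<delta> where \<delta>: "\<delta> > 0" and unif: "\<And>z w. dist z w < \<delta> \<Longrightarrow> sph_dist (f z) (f w) < 1 / 4"
    using spherically_uniformly_continuous by metis
  define R where "R = \<delta> / 2"
  have R: "R > 0" using \<delta> by (simp add: R_def)
  obtain \<eta> where \<eta>: "\<eta> > 0" and big: "\<And>c. \<exists>z\<in>ball c (R / 2). z \<in> pole_set f \<or> \<eta> \<le> norm (the (f z))"
    using not_uniformly_small_on_balls[of "R / 2"] R by auto
  \<comment> \<open>The exponent is the oscillation bound with \<open>M = 2\<close>, applied between
    \<open>c\<close> and a point where the modulus is at least \<eta>; the 1 covers points where the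
    modulus exceeds 1.\<close>
  define m where "m = min 1 (\<eta> * exp (- (2 * (ln (2 / \<eta>) + 1))))"
  have m: "m > 0" using \<eta> by (simp add: m_def)
  have low: "m \<le> norm (the (f c))" if c: "c \<notin> pole_set f" for c
  proof (cases "norm (the (f c)) \<le> 1")
    case True
    note ch = chart[of \<delta>, OF unif c True]
    obtain z0 where z0: "z0 \<in> ball c (R / 2)" "z0 \<in> pole_set f \<or> \<eta> \<le> norm (the (f z0))"
      using big by blast
    have sub: "ball z0 R \<subseteq> ball c \<delta>"
    proof
      fix z assume "z \<in> ball z0 R"
      then show "z \<in> ball c \<delta>" using z0(1) dist_triangle[of c z z0] \<delta> by (simp add: R_def)
    qed
    moreover have "z0 \<in> ball z0 R" using R by simp
    ultimately have "z0 \<notin> pole_set f" using ch(1) by blast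
    then have z0b: "\<eta> \<le> norm (the (f z0))" using z0(2) by blast
    obtain g where g: "\<And>z. z \<in> ball z0 R \<Longrightarrow> the (f z) = exp (g z)"
      "\<And>z. z \<in> cball z0 (R/2) \<Longrightarrow> norm (g z - g z0) \<le> 2 * (ln (2 / \<eta>) + 1)"
    proof (rule zero_free_log_oscillation[of "\<lambda>z. the (f z)" z0 R 2 \<eta>])
      show "(\<lambda>z. the (f z)) holomorphic_on ball z0 R"
        by (rule holomorphic_on_subset[OF holo]) (use ch(1) sub in blast)
      show "the (f z) \<noteq> 0" if "z \<in> ball z0 R" for z
        using the_eq_0_iff[of z] none ch(1) sub that by auto
      show "norm (the (f z)) \<le> 2" if "z \<in> ball z0 R" for z using ch(2) sub that by blast
    qed (use R z0b \<eta> in auto)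
    have cz: "c \<in> cball z0 (R / 2)" "c \<in> ball z0 R" using z0(1) R by (auto simp: dist_commute)
    have "Re (g z0) - Re (g c) \<le> norm (g c - g z0)"
      using abs_Re_le_cmod[of "g c - g z0"] by simp
    then have "Re (g z0) - Re (g c) \<le> 2 * (ln (2 / \<eta>) + 1)" using g(2)[OF cz(1)] by linarith
    then have "exp (Re (g z0)) * exp (- (2 * (ln (2 / \<eta>) + 1))) \<le> exp (Re (g c))"
      unfolding exp_add[symmetric] by simp
    moreover have "norm (the (f c)) = exp (Re (g c))" "norm (the (f z0)) = exp (Re (g z0))"
      using g(1) cz(2) R by auto
    ultimately have "norm (the (f z0)) * exp (- (2 * (ln (2 / \<eta>) + 1))) \<le> norm (the (f c))" by simp
    moreover have "\<eta> * exp (- (2 * (ln (2 / \<eta>) + 1))) \<le> norm (the (f z0)) * exp (- (2 * (ln (2 / \<eta>) + 1)))"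
      using z0b by (intro mult_right_mono) auto
    ultimately have "\<eta> * exp (- (2 * (ln (2 / \<eta>) + 1))) \<le> norm (the (f c))" by linarith
    then show ?thesis unfolding m_def by (rule min.coboundedI2)
  qed (auto simp: m_def)
  define G where "G = (\<lambda>z. the ((recip \<circ> f) z))"
  have holG: "G holomorphic_on UNIV"
    using meromorphic_recip none unfolding meromorphic_C_def pole_set_recip by (simp add: G_def)
  have "norm (G z) \<le> 1 / m" for z
  proof (cases "z \<in> pole_set f")
    case True
    then show ?thesis using m by (simp add: G_def pole_set_def)
  next
    case False
    then have "G z = inverse (the (f z))" using recip_eq_inverse[OF False] none by (simp add: G_def)
    moreover have "inverse (norm (the (f z))) \<le> inverse m"
      using low[OF False] m by (rule le_imp_inverse_le)
    ultimately show ?thesis by (simp add: norm_divide inverse_eq_divide)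
  qed
  then have "bounded (range G)" by (auto simp: bounded_iff)
  then obtain c where c: "G z = c" for z using Liouville_theorem[OF holG] by (metis constant_on_def UNIV_I)
  have "recip (f z) = Some c" for z
  proof (cases "f z")
    case (Some a)
    then have "a \<noteq> 0" using none by (auto simp: zeros_def)
    then show ?thesis using Some c[of z] by (simp add: G_def)
  qed (use c[of z] in \<open>simp add: G_def\<close>)
  then have "f z = recip (Some c)" for z using recip_recip[of "f z"] by simp
  then show False using nonconst by blast
qed

text \<open>A Hurwitz argument: on a circle about a zero \<open>a\<close> the modulus is at least
  \<open>m\<close>, and an almost period perturbs \<open>f\<close> by at most \<open>m / 3\<close>.
  If the translate had no zero in the disc, its reciprocal would be at most
  \<open>3 / (2 * m)\<close> on the circle but at least \<open>3 / m\<close> at the centre.\<close>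

lemma zeros_relatively_dense:
  obtains L where "L > 0" "\<And>c. \<exists>z\<in>cball c L. z \<in> zeros"
proof -
  obtain a where a: "a \<in> zeros" using zeros_nonempty by blast
  have "\<forall>\<^sub>F w in at a. w \<notin> pole_set f \<and> w \<notin> zeros"
    using eventually_not_pole[of a] eventually_not_zero[of a] by eventually_elim auto
  then obtain r0 where r0: "r0 > 0" "\<And>w. w \<noteq> a \<Longrightarrow> dist w a < r0 \<Longrightarrow> w \<notin> pole_set f \<and> w \<notin> zeros"
    by (auto simp: eventually_at)
  define r where "r = r0 / 2"
  have r: "r > 0" using r0 by (simp add: r_def)
  have nopole: "w \<notin> pole_set f" if "w \<in> cball a r" for w
    using that r0 zeros_disjoint[OF a] by (cases "w = a") (auto simp: r_def dist_commute)
  have cont: "continuous_on (cball a r) (\<lambda>z. the (f z))"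
    by (intro continuous_at_imp_continuous_on ballI isCont_off_poles nopole)
  have contn: "continuous_on K (\<lambda>z. norm (the (f z)))" if "K \<subseteq> cball a r" for K
    by (intro continuous_intros continuous_on_subset[OF cont that])
  have ssub: "sphere a r \<subseteq> cball a r" by auto
  obtain w1 where w1: "w1 \<in> sphere a r" "\<And>w. w \<in> sphere a r \<Longrightarrow> norm (the (f w1)) \<le> norm (the (f w))"
    using continuous_attains_inf[OF compact_sphere _ contn[OF ssub]] r by force
  define m where "m = norm (the (f w1))"
  have "w1 \<notin> zeros" using r0(2)[of w1] w1(1) r by (auto simp: r_def dist_commute)
  then have m: "m > 0" using the_eq_0_iff[OF nopole[OF subsetD[OF ssub w1(1)]]] by (simp add: m_def)
  obtain w2 where w2: "\<And>w. w \<in> cball a r \<Longrightarrow> norm (the (f w)) \<le> norm (the (f w2))"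
    using continuous_attains_sup[OF compact_cball _ contn[OF order_refl]] r by force
  define B where "B = norm (the (f w2))"
  have B: "1 + B > 0" by (simp add: B_def add_pos_nonneg)
  \<comment> \<open>The two terms give the hypothesis of \<open>sph_dist_close\<close> and the error
    \<open>m / 3\<close>, respectively.\<close>
  define \<epsilon> where "\<epsilon> = min (1 / (1 + B)) (m / (3 * (1 + B)\<^sup>2))"
  have \<epsilon>: "\<epsilon> > 0" using m B by (simp add: \<epsilon>_def)
  have "\<epsilon> \<le> 1 / (1 + B)" "\<epsilon> \<le> m / (3 * (1 + B)\<^sup>2)" by (simp_all add: \<epsilon>_def)
  then have e1: "\<epsilon> * (1 + B) \<le> 1" and e2: "\<epsilon> * (1 + B)\<^sup>2 \<le> m / 3"
    using B by (simp_all add: field_simps)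
  obtain L where L: "L > 0" "\<And>c. \<exists>\<tau>\<in>cball c L. \<forall>z. sph_dist (f (z + \<tau>)) (f z) < \<epsilon>"
    using almost_periods[OF \<epsilon>] by auto
  show ?thesis
  proof (rule that[of "L + r"])
    fix c
    obtain \<tau> where \<tau>: "\<tau> \<in> cball (c - a) L" "\<And>z. sph_dist (f (z + \<tau>)) (f z) < \<epsilon>" using L(2) by blast
    have close: "z + \<tau> \<notin> pole_set f \<and> norm (the (f (z + \<tau>)) - the (f z)) \<le> m / 3" if z: "z \<in> cball a r" for z
    proof -
      have "norm (the (f z)) \<le> B" using w2[OF z] by (simp add: B_def)
      moreover have "sph_dist (f (z + \<tau>)) (Some (the (f z))) < \<epsilon>"
        using \<tau>(2)[of z] not_pole[OF nopole[OF z]] by simp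
      ultimately obtain b where "f (z + \<tau>) = Some b" "norm (b - the (f z)) \<le> \<epsilon> * (1 + B)\<^sup>2"
        using sph_dist_close[OF _ e1 \<epsilon>] by metis
      then show ?thesis using e2 by (auto simp: pole_set_def)
    qed
    have "\<exists>z\<in>cball a r. z + \<tau> \<in> zeros"
    proof (rule ccontr)
      assume "\<not> ?thesis"
      then have nz: "the (f (z + \<tau>)) \<noteq> 0" if "z \<in> cball a r" for z
        using close[OF that] the_eq_0_iff that by blast
      define G where "G = (\<lambda>z. inverse (the (f (z + \<tau>))))"
      have contf: "continuous_on (cball a r) (\<lambda>z. the (f (z + \<tau>)))"
      proof (rule continuous_on_compose2[OF holomorphic_on_imp_continuous_on[OF holo]])
        show "(\<lambda>z. z + \<tau>) ` cball a r \<subseteq> - pole_set f" using close by blast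
      qed (intro continuous_intros)
      have holf: "(\<lambda>z. the (f (z + \<tau>))) holomorphic_on ball a r"
      proof (rule holomorphic_on_compose_gen[OF _ holo, unfolded o_def])
        show "(\<lambda>z. z + \<tau>) ` ball a r \<subseteq> - pole_set f"
          using close ball_subset_cball[of a r] by blast
      qed (intro holomorphic_intros)
      have "norm (G a) \<le> 3 / (2 * m)"
      proof (rule maximum_modulus_frontier[of G "cball a r"])
        show "G holomorphic_on interior (cball a r)"
          unfolding G_def interior_cball by (intro holomorphic_intros holf) (use nz in auto)
        show "continuous_on (closure (cball a r)) G"
          unfolding G_def closure_closed[OF closed_cball] by (intro continuous_intros contf) (use nz in auto)
        show "norm (G z) \<le> 3 / (2 * m)" if "z \<in> frontier (cball a r)" for z
        proof -
          have z: "z \<in> sphere a r" using that r by simp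
          have "m \<le> norm (the (f z))" using w1(2)[OF z] by (simp add: m_def)
          moreover have "norm (the (f z)) \<le> norm (the (f (z + \<tau>))) + norm (the (f (z + \<tau>)) - the (f z))"
            using norm_triangle_ineq4[of "the (f (z + \<tau>))" "the (f (z + \<tau>)) - the (f z)"] by simp
          ultimately have "2 * m / 3 \<le> norm (the (f (z + \<tau>)))" using close[of z] z by simp
          then have "inverse (norm (the (f (z + \<tau>)))) \<le> inverse (2 * m / 3)" using m by (intro le_imp_inverse_le) auto
          then show ?thesis by (simp add: G_def norm_inverse)
        qed
      qed (use r in auto)
      moreover have "norm (G a) \<ge> 3 / m"
      proof -
        have ar: "a \<in> cball a r" using r by simp
        have "norm (the (f (a + \<tau>))) \<le> m / 3" using close[OF ar] a by (simp add: zeros_def)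
        then have "inverse (m / 3) \<le> inverse (norm (the (f (a + \<tau>))))"
          using nz[OF ar] by (intro le_imp_inverse_le) auto
        then show ?thesis by (simp add: G_def norm_inverse)
      qed
      ultimately show False using m by (simp add: field_simps)
    qed
    then obtain z where z: "z \<in> cball a r" "z + \<tau> \<in> zeros" by blast
    have "norm (z + \<tau> - c) \<le> norm (\<tau> - (c - a)) + norm (z - a)"
      using norm_triangle_ineq[of "\<tau> - (c - a)" "z - a"] by (simp add: algebra_simps)
    then have "z + \<tau> \<in> cball c (L + r)" using \<tau>(1) z(1) by (simp add: dist_norm norm_minus_commute)
    then show "\<exists>z\<in>cball c (L + r). z \<in> zeros" using z(2) by blast
  qed (use L r in auto)
qed

text \<open>The estimate is centred not at \<open>u\<close>, where \<open>f\<close> may be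
  arbitrarily small, but at a nearby \<open>z0\<close> with modulus at least \<eta>. With
  \<open>R = \<delta> / 6\<close> the disc of radius \<open>5 * R\<close> about \<open>z0\<close>
  stays in the chart at \<open>u\<close>, because \<open>5 * R + R / 4 < \<delta>\<close>.\<close>

lemma short_segment_bound_finite_chart:
  assumes \<delta>: "\<delta> > 0" and unif: "\<And>z w. dist z w < \<delta> \<Longrightarrow> sph_dist (f z) (f w) < 1 / 4"
    and R: "R = \<delta> / 6"
  obtains C where "\<And>u v. \<lbrakk>dist u v \<le> R / 4; closed_segment u v \<inter> (zeros \<union> pole_set f) = {};
      norm (the (f u)) \<le> 1\<rbrakk> \<Longrightarrow> \<bar>Im (contour_integral (linepath u v) (log_deriv f))\<bar> \<le> C"
proof -
  have Rp: "R > 0" using R \<delta> by simp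
  obtain \<eta> where \<eta>: "\<eta> > 0" and big: "\<And>c. \<exists>z\<in>ball c (R / 4). z \<in> pole_set f \<or> \<eta> \<le> norm (the (f z))"
    using not_uniformly_small_on_balls[of "R / 4"] Rp by auto
  obtain k :: nat where "2 / \<eta> < 2 ^ k" using real_arch_pow[of 2] by auto
  then have k: "2 \<le> 2 ^ k * \<eta>" using \<eta> by (simp add: field_simps)
  have "\<bar>Im (contour_integral (linepath u v) (log_deriv f))\<bar> \<le> 8 * (real k + 1)"
    if uv: "dist u v \<le> R / 4" and avoid: "closed_segment u v \<inter> (zeros \<union> pole_set f) = {}"
      and fu: "norm (the (f u)) \<le> 1" for u v
  proof -
    have u: "u \<notin> pole_set f" using avoid by auto
    note ch = chart[of \<delta>, OF unif u fu]
    obtain z0 where z0: "z0 \<in> ball u (R / 4)" "z0 \<in> pole_set f \<or> \<eta> \<le> norm (the (f z0))"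
      using big by blast
    have sub: "ball z0 (5 * R) \<subseteq> ball u \<delta>"
    proof
      fix z assume "z \<in> ball z0 (5 * R)"
      then show "z \<in> ball u \<delta>" using z0(1) dist_triangle[of u z z0] \<delta> by (simp add: R)
    qed
    have "z0 \<in> ball z0 (5 * R)" using Rp by simp
    then have z0p: "z0 \<notin> pole_set f" using ch(1) sub by blast
    show ?thesis
      unfolding log_deriv_def
    proof (rule log_deriv_integral_bound[OF Rp \<eta>, where M = 2 and ?z0.0 = z0])
      show "(\<lambda>z. the (f z)) holomorphic_on ball z0 (5 * R)"
        by (rule holomorphic_on_subset[OF holo]) (use ch(1) sub in blast)
      show "norm (the (f z)) \<le> 2" if "z \<in> sphere z0 (4 * R)" for z
      proof -
        have "z \<in> ball z0 (5 * R)" using that Rp by simp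
        then show ?thesis using ch(2) sub by blast
      qed
      show "u \<in> cball z0 (R / 2)" using z0(1) Rp by (simp add: dist_commute)
      show "v \<in> cball z0 (R / 2)" using z0(1) uv dist_triangle[of z0 v u] by (simp add: dist_commute)
      show "the (f z) \<noteq> 0" if "z \<in> closed_segment u v" for z
        using the_eq_0_iff[of z] avoid that by blast
    qed (use z0 z0p k in auto)
  qed
  then show ?thesis using that by blast
qed

text \<open>At \<open>u\<close> either \<open>f\<close> or \<open>1 / f\<close> has modulus at most
  1, and passing to \<open>1 / f\<close> only changes the sign of the logarithmic
  derivative.\<close>

lemma short_segment_bound:
  obtains h C where "h > 0" "\<And>u v. \<lbrakk>dist u v \<le> h; closed_segment u v \<inter> (zeros \<union> pole_set f) = {}\<rbrakk>
     \<Longrightarrow> \<bar>Im (contour_integral (linepath u v) (log_deriv f))\<bar> \<le> C"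
proof -
  interpret r: almost_elliptic_fun "recip \<circ> f"
    by unfold_locales (rule almost_elliptic_recip)
  have rzeros: "r.zeros = pole_set f"
    using r.pole_set_recip by (simp add: o_def)
  obtain \<delta> where \<delta>: "\<delta> > 0" and unif: "\<And>z w. dist z w < \<delta> \<Longrightarrow> sph_dist (f z) (f w) < 1 / 4"
    using spherically_uniformly_continuous by metis
  have unif': "sph_dist ((recip \<circ> f) z) ((recip \<circ> f) w) < 1 / 4" if "dist z w < \<delta>" for z w
    using unif[OF that] by (simp add: sph_dist_recip)
  define R where "R = \<delta> / 6"
  obtain C1 where C1: "\<And>u v. \<lbrakk>dist u v \<le> R / 4; closed_segment u v \<inter> (zeros \<union> pole_set f) = {};
      norm (the (f u)) \<le> 1\<rbrakk> \<Longrightarrow> \<bar>Im (contour_integral (linepath u v) (log_deriv f))\<bar> \<le> C1"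
    using short_segment_bound_finite_chart[OF \<delta> unif R_def] by metis
  obtain C2 where C2: "\<And>u v. \<lbrakk>dist u v \<le> R / 4; closed_segment u v \<inter> (zeros \<union> pole_set f) = {};
      norm (the ((recip \<circ> f) u)) \<le> 1\<rbrakk> \<Longrightarrow> \<bar>Im (contour_integral (linepath u v) (log_deriv (recip \<circ> f)))\<bar> \<le> C2"
    using r.short_segment_bound_finite_chart[OF \<delta> unif' R_def] unfolding rzeros pole_set_recip
    by (metis Un_commute)
  have "\<bar>Im (contour_integral (linepath u v) (log_deriv f))\<bar> \<le> max C1 C2"
    if uv: "dist u v \<le> R / 4" "closed_segment u v \<inter> (zeros \<union> pole_set f) = {}" for u v
  proof (cases "norm (the (f u)) \<le> 1")
    case True
    then show ?thesis using C1[OF uv] by linarith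
  next
    case False
    have u: "u \<notin> zeros" "u \<notin> pole_set f" using uv(2) by auto
    have "norm (the ((recip \<circ> f) u)) \<le> 1"
      using False recip_eq_inverse[OF u(2,1)] by (simp add: norm_inverse inverse_le_1_iff)
    then have "\<bar>Im (contour_integral (linepath u v) (log_deriv (recip \<circ> f)))\<bar> \<le> C2" by (rule C2[OF uv])
    also have "contour_integral (linepath u v) (log_deriv (recip \<circ> f))
        = contour_integral (linepath u v) (\<lambda>z. - log_deriv f z)"
      by (rule contour_integral_eq, rule log_deriv_recip) (use uv(2) in auto)
    also have "\<dots> = - contour_integral (linepath u v) (log_deriv f)" by (rule contour_integral_neg)
    finally show ?thesis by simp
  qed
  then show ?thesis using that[of "R / 4" "max C1 C2"] \<delta> by (simp add: R_def)
qed

end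

subsection \<open>The argument principle on rectangles\<close>

context nonconst_mero
begin

section \<open>Orders of zeros and poles\<close>

lemma open_Compl_other_poles: "open (- (pole_set f - {w}))"
proof -
  have "closed (pole_set f - {w})"
    using no_limpt_poles islimpt_subset[of _ "pole_set f - {w}" "pole_set f"] closed_limpt by blast
  then show ?thesis by (rule open_Compl)
qed

lemma holo_punctured: "(\<lambda>z. the (f z)) holomorphic_on - (pole_set f - {w}) - {w}"
  by (rule holomorphic_on_subset[OF holo]) auto

lemma frequently_nonzero: "\<exists>\<^sub>F z in at w. the (f z) \<noteq> 0"
proof (rule eventually_frequently)
  show "\<forall>\<^sub>F z in at w. the (f z) \<noteq> 0"
    using eventually_not_pole[of w] eventually_not_zero[of w] by eventually_elim (simp add: the_eq_0_iff)
qed simp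

text \<open>Connects multiplicities with the argument principle. Both orders depend on a punctured
  neighbourhood only, so the arbitrary value of \<open>the (f w)\<close> at a pole is
  harmless.\<close>

lemma mero_order_eq_zorder: "mero_order f w = zorder (\<lambda>z. the (f z)) w"
  unfolding mero_order_def
proof (rule the_equality)
  let ?F = "\<lambda>z. the (f z)"
  let ?n = "zorder ?F w"
  have "isolated_singularity_at ?F w"
    by (rule isolated_singularity_at_holomorphic[OF holo_punctured open_Compl_other_poles]) simp
  moreover have "not_essential ?F w"
    unfolding not_essential_def is_pole_def using at_pole isCont_off_poles isContD by blast
  ultimately obtain g r where g: "g w \<noteq> 0" "r > 0" "g holomorphic_on cball w r"
      "\<And>z. z \<in> cball w r - {w} \<Longrightarrow> ?F z = g z * (z - w) powi ?n"
    using zorder_exist[OF _ _ frequently_nonzero] by metis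
  obtain d where d: "d > 0" "\<And>z. z \<noteq> w \<Longrightarrow> dist z w < d \<Longrightarrow> z \<notin> pole_set f"
    using eventually_not_pole[of w] by (auto simp: eventually_at)
  show "\<exists>g r. r > 0 \<and> g holomorphic_on ball w r \<and> g w \<noteq> 0 \<and>
       (\<forall>z \<in> ball w r - {w}. f z = Some ((z - w) powi ?n * g z))"
  proof (intro exI conjI ballI)
    show "min r d > 0" using g(2) d(1) by simp
    show "g holomorphic_on ball w (min r d)" by (rule holomorphic_on_subset[OF g(3)]) auto
    show "g w \<noteq> 0" by (rule g(1))
    fix z assume z: "z \<in> ball w (min r d) - {w}"
    then have "f z = Some (?F z)" using d(2)[of z] by (intro not_pole) (auto simp: dist_commute)
    moreover have "?F z = g z * (z - w) powi ?n" using z by (intro g(4)) auto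
    ultimately show "f z = Some ((z - w) powi ?n * g z)" by (metis mult.commute)
  qed
next
  fix n assume "\<exists>g r. r > 0 \<and> g holomorphic_on ball w r \<and> g w \<noteq> 0 \<and>
       (\<forall>z \<in> ball w r - {w}. f z = Some ((z - w) powi n * g z))"
  then obtain g r where g: "r > 0" "g holomorphic_on ball w r" "g w \<noteq> 0"
    "\<And>z. z \<in> ball w r - {w} \<Longrightarrow> f z = Some ((z - w) powi n * g z)" by blast
  show "n = zorder (\<lambda>z. the (f z)) w"
    by (rule zorder_eqI[OF open_ball _ g(2,3), symmetric]) (use g(1,4) in auto)
qed

lemma mero_order_off_poles:
  assumes "w \<notin> pole_set f"
  shows "if w \<in> zeros then mero_order f w > 0 else mero_order f w = 0"
proof -
  obtain v where "v \<notin> pole_set f" "the (f v) \<noteq> 0"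
    using frequently_ex[OF frequently_eventually_frequently[OF frequently_nonzero eventually_not_pole]] by auto
  then have ex: "\<exists>v\<in>- pole_set f. the (f v) \<noteq> 0" by blast
  have "if the (f w) = 0 then zorder (\<lambda>z. the (f z)) w > 0 else zorder (\<lambda>z. the (f z)) w = 0"
    using zorder_exist_zero[OF holo open_compl_poles connected_compl_poles _ ex, of w] assms
    by (auto split: if_splits)
  then show ?thesis using the_eq_0_iff[OF assms] by (simp add: mero_order_eq_zorder)
qed

lemma mero_order_pole:
  assumes "w \<in> pole_set f" shows "mero_order f w < 0"
  using zorder_exist_pole[OF holo_punctured open_Compl_other_poles, of w] at_pole[OF assms]
  by (simp add: is_pole_def mero_order_eq_zorder)

lemma zero_mult_pos_iff: "zero_mult f w > 0 \<longleftrightarrow> w \<in> zeros"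
  using mero_order_off_poles[of w] mero_order_pole[of w] zeros_disjoint[of w]
  by (cases "w \<in> pole_set f"; cases "w \<in> zeros") (auto simp: zero_mult_def)

lemma pole_mult_pos_iff: "pole_mult f w > 0 \<longleftrightarrow> w \<in> pole_set f"
  using mero_order_off_poles[of w] mero_order_pole[of w]
  by (cases "w \<in> pole_set f"; cases "w \<in> zeros") (auto simp: pole_mult_def)

section \<open>Integrals of the logarithmic derivative over rectangles and edges\<close>

lemma continuous_log_deriv:
  assumes "K \<inter> (zeros \<union> pole_set f) = {}" shows "continuous_on K (log_deriv f)"
  unfolding log_deriv_def
  by (rule holomorphic_imp_continuous_log_deriv[OF holo open_compl_poles])
     (use assms the_eq_0_iff in auto)

lemma rectangle_argument_principle:
  assumes ab: "Re a < Re b" "Im a < Im b"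
    and avoid: "path_image (rectpath a b) \<inter> (zeros \<union> pole_set f) = {}"
  shows "contour_integral (rectpath a b) (log_deriv f)
    = 2 * pi * \<i> * of_int (\<Sum>p\<in>box a b \<inter> (zeros \<union> pole_set f). mero_order f p)"
proof -
  \<comment> \<open>A margin of 1 puts the closed rectangle into an open convex set with finitely
    many divisor points; those outside the rectangle have winding number 0.\<close>
  define S where "S = box (a - Complex 1 1) (b + Complex 1 1)"
  define pz where "pz = {w \<in> S. the (f w) = 0 \<or> w \<in> pole_set f}"
  have pz: "pz = S \<inter> (zeros \<union> pole_set f)" using the_eq_0_iff by (auto simp: pz_def)
  have sub: "cbox a b \<subseteq> S" by (auto simp: S_def in_box_complex_iff in_cbox_complex_iff)
  have wn0: "winding_number (rectpath a b) z = 0" if "z \<notin> cbox a b" for z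
    using winding_number_rectpath_outside[of a b z] ab that by simp
  have fin: "finite pz" unfolding pz by (rule finite_zeros_poles_bounded) (simp add: S_def)
  have "contour_integral (rectpath a b) (\<lambda>x. deriv (\<lambda>z. the (f z)) x * 1 / the (f x)) = 2 * pi * \<i> *
          (\<Sum>p\<in>pz. winding_number (rectpath a b) p * 1 * zorder (\<lambda>z. the (f z)) p)"
    unfolding pz_def
  proof (rule argument_principle)
    show "open S" "connected S" by (auto simp: S_def intro: convex_connected)
    show "(\<lambda>z. the (f z)) holomorphic_on S - pole_set f" by (rule holomorphic_on_subset[OF holo]) auto
    show "path_image (rectpath a b) \<subseteq> S - {w \<in> S. the (f w) = 0 \<or> w \<in> pole_set f}"
      using avoid path_image_rectpath_subset_cbox[of a b] ab sub pz unfolding pz_def by fastforce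
    show "\<forall>z. z \<notin> S \<longrightarrow> winding_number (rectpath a b) z = 0" using wn0 sub by blast
    show "finite {w \<in> S. the (f w) = 0 \<or> w \<in> pole_set f}" using fin by (simp add: pz_def)
    show "\<forall>p\<in>S \<inter> pole_set f. is_pole (\<lambda>z. the (f z)) p" using at_pole by (auto simp: is_pole_def)
  qed auto
  also have "(\<Sum>p\<in>pz. winding_number (rectpath a b) p * 1 * zorder (\<lambda>z. the (f z)) p)
      = (\<Sum>p\<in>box a b \<inter> (zeros \<union> pole_set f). of_int (mero_order f p))"
  proof (rule sum.mono_neutral_cong_right[OF fin])
    show "box a b \<inter> (zeros \<union> pole_set f) \<subseteq> pz" using sub box_subset_cbox[of a b] by (auto simp: pz)
    show "\<forall>p\<in>pz - box a b \<inter> (zeros \<union> pole_set f).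
        winding_number (rectpath a b) p * 1 * zorder (\<lambda>z. the (f z)) p = 0"
    proof
      fix p assume p: "p \<in> pz - box a b \<inter> (zeros \<union> pole_set f)"
      then have "p \<notin> path_image (rectpath a b)" using avoid pz by blast
      then have "p \<notin> cbox a b" using p pz path_image_rectpath_cbox_minus_box[of a b] ab by auto
      then show "winding_number (rectpath a b) p * 1 * zorder (\<lambda>z. the (f z)) p = 0" by (simp add: wn0)
    qed
  qed (simp add: winding_number_rectpath mero_order_eq_zorder)
  finally show ?thesis by (simp add: log_deriv_def[abs_def])
qed

text \<open>All edges are directed towards increasing coordinates, so the two cells sharing an edge
  use the same integral with opposite signs.\<close>

lemma contour_integral_rectpath:
  fixes a b :: complex
  defines "c \<equiv> Complex (Re b) (Im a)" and "d \<equiv> Complex (Re a) (Im b)"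
  assumes avoid: "path_image (rectpath a b) \<inter> (zeros \<union> pole_set f) = {}"
  shows "contour_integral (rectpath a b) (log_deriv f)
    = contour_integral (linepath a c) (log_deriv f) + contour_integral (linepath c b) (log_deriv f)
      - contour_integral (linepath d b) (log_deriv f) - contour_integral (linepath a d) (log_deriv f)"
proof -
  have im: "path_image (rectpath a b) = closed_segment a c \<union> closed_segment c b \<union> closed_segment b d \<union> closed_segment d a"
    by (simp add: rectpath_def Let_def path_image_join Un_assoc c_def d_def)
  have cont: "continuous_on (closed_segment u v) (log_deriv f)"
    if "closed_segment u v \<subseteq> path_image (rectpath a b)" for u v
    by (rule continuous_log_deriv) (use avoid that in blast)
  have int: "log_deriv f contour_integrable_on linepath u v"
    if "closed_segment u v \<subseteq> path_image (rectpath a b)" for u v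
    by (rule contour_integrable_continuous_linepath[OF cont[OF that]])
  have ints: "log_deriv f contour_integrable_on linepath a c" "log_deriv f contour_integrable_on linepath c b"
    "log_deriv f contour_integrable_on linepath b d" "log_deriv f contour_integrable_on linepath d a"
    by (intro int; use im in blast)+
  have "contour_integral (rectpath a b) (log_deriv f)
    = contour_integral (linepath a c) (log_deriv f) + (contour_integral (linepath c b) (log_deriv f)
      + (contour_integral (linepath b d) (log_deriv f) + contour_integral (linepath d a) (log_deriv f)))"
    unfolding rectpath_def Let_def c_def[symmetric] d_def[symmetric]
    using ints by (simp add: contour_integrable_joinI)
  moreover have "contour_integral (linepath b d) (log_deriv f) = - contour_integral (linepath d b) (log_deriv f)"
    "contour_integral (linepath d a) (log_deriv f) = - contour_integral (linepath a d) (log_deriv f)"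
    by (intro contour_integral_reverse_linepath cont; use im in blast)+
  ultimately show ?thesis by simp
qed

text \<open>Up to the principal arguments at its end points, the change of argument along a segment is an
  integral multiple of \<open>2 * pi\<close>. The end point terms cancel around closed polygons, so the flow of
  zeros minus poles across segments may be taken to be integral.\<close>
definition flow :: "complex \<Rightarrow> complex \<Rightarrow> int" where
  "flow u v = \<lfloor>(Im (contour_integral (linepath u v) (log_deriv f))
      - (Im (Ln (the (f v))) - Im (Ln (the (f u))))) / (2 * pi)\<rfloor>"

text \<open>The floor in \<open>flow\<close> is exact: near the segment \<open>f\<close> has a
  holomorphic logarithm, whose imaginary part differs from the principal argument by an integral
  multiple of \<open>2 * pi\<close> at either end.\<close>

lemma flow_eq:
  assumes avoid: "closed_segment u v \<inter> (zeros \<union> pole_set f) = {}"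
  shows "2 * pi * of_int (flow u v) = Im (contour_integral (linepath u v) (log_deriv f))
      - (Im (Ln (the (f v))) - Im (Ln (the (f u))))"
proof -
  obtain e where e: "e > 0" "(\<Union>x\<in>closed_segment u v. ball x e) \<subseteq> - (zeros \<union> pole_set f)"
    using compact_subset_open_imp_ball_epsilon_subset[OF compact_segment open_good] avoid by blast
  \<comment> \<open>A Minkowski sum of convex sets, hence a convex neighbourhood of the segment, as
    the existence of a logarithm requires.\<close>
  define T where "T = {x + y | x y. x \<in> closed_segment u v \<and> y \<in> ball 0 e}"
  have "T = (\<Union>x\<in>closed_segment u v. ball x e)"
  proof (intro set_eqI iffI)
    fix z assume "z \<in> (\<Union>x\<in>closed_segment u v. ball x e)"
    then obtain x where x: "x \<in> closed_segment u v" "dist x z < e" by auto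
    have "z = x + (z - x)" "z - x \<in> ball 0 e" using x by (simp_all add: dist_norm norm_minus_commute)
    then show "z \<in> T" using x unfolding T_def by blast
  next
    fix z assume "z \<in> T"
    then obtain x y where "x \<in> closed_segment u v" "y \<in> ball 0 e" "z = x + y" unfolding T_def by blast
    then show "z \<in> (\<Union>x\<in>closed_segment u v. ball x e)" by (intro UN_I[of x]) (auto simp: dist_norm)
  qed
  then have T: "open T" "T \<subseteq> - (zeros \<union> pole_set f)" "closed_segment u v \<subseteq> T"
    using e by auto
  have "convex T"
  proof -
    have "T = (\<Union>x\<in>closed_segment u v. \<Union>y\<in>ball 0 e. {x + y})" unfolding T_def by blast
    then show ?thesis by (simp add: convex_sums)
  qed
  then have "contractible T" by (rule convex_imp_contractible)
  moreover have "(\<lambda>z. the (f z)) holomorphic_on T" by (rule holomorphic_on_subset[OF holo]) (use T(2) in auto)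
  moreover have nz: "the (f z) \<noteq> 0" if "z \<in> T" for z using that T(2) the_eq_0_iff[of z] by auto
  ultimately obtain g where g: "g holomorphic_on T" "\<And>z. z \<in> T \<Longrightarrow> the (f z) = exp (g z)"
    using contractible_imp_holomorphic_log[of "\<lambda>z. the (f z)" T] by metis
  have int: "contour_integral (linepath u v) (log_deriv f) = g v - g u"
    unfolding log_deriv_def by (rule log_deriv_integral_exp[OF g(1) T(1,3) g(2)])
  have arg: "\<exists>k::int. Im (g z) = Im (Ln (the (f z))) + 2 * pi * k" if "z \<in> T" for z
  proof -
    have "exp (g z) = exp (Ln (the (f z)))" using g(2)[OF that] nz[OF that] by simp
    then obtain k :: int where "g z = Ln (the (f z)) + of_int (2 * k) * pi * \<i>" using exp_eq by metis
    then show ?thesis by (intro exI[of _ k]) simp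
  qed
  have "u \<in> T" "v \<in> T" using T(3) by auto
  then obtain k l :: int where "Im (g u) = Im (Ln (the (f u))) + 2 * pi * k" "Im (g v) = Im (Ln (the (f v))) + 2 * pi * l"
    using arg by metis
  then have "Im (contour_integral (linepath u v) (log_deriv f))
      - (Im (Ln (the (f v))) - Im (Ln (the (f u)))) = 2 * pi * of_int (l - k)"
    unfolding int by (simp add: algebra_simps)
  then show ?thesis by (simp add: flow_def)
qed

end

section \<open>Linear bounds for argument changes and flows along long segments\<close>

context almost_elliptic_fun
begin

lemma segment_bound:
  obtains h C where "h > 0" "C \<ge> 0"
    "\<And>n u v. \<lbrakk>dist u v \<le> real n * h; closed_segment u v \<inter> (zeros \<union> pole_set f) = {}\<rbrakk>
     \<Longrightarrow> \<bar>Im (contour_integral (linepath u v) (log_deriv f))\<bar> \<le> real n * C"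
proof -
  obtain h C0 where h: "h > 0" and short: "\<And>u v. \<lbrakk>dist u v \<le> h; closed_segment u v \<inter> (zeros \<union> pole_set f) = {}\<rbrakk>
     \<Longrightarrow> \<bar>Im (contour_integral (linepath u v) (log_deriv f))\<bar> \<le> C0"
    using short_segment_bound by metis
  define C where "C = max C0 0"
  have "\<bar>Im (contour_integral (linepath u v) (log_deriv f))\<bar> \<le> real n * C"
    if "dist u v \<le> real n * h" "closed_segment u v \<inter> (zeros \<union> pole_set f) = {}" for n u v
    using that
  proof (induction n arbitrary: u)
    case (Suc n u)
    show ?case
    proof (cases "dist u v \<le> h")
      case True
      then have "\<bar>Im (contour_integral (linepath u v) (log_deriv f))\<bar> \<le> C"
        using short[OF True Suc.prems(2)] by (simp add: C_def)
      also have "\<dots> \<le> real (Suc n) * C" by (simp add: C_def distrib_right)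
      finally show ?thesis .
    next
      case False
      define t where "t = h / dist u v"
      define w where "w = (1 - t) *\<^sub>R u + t *\<^sub>R v"
      have "dist u v > 0" using False h by linarith
      then have t: "0 \<le> t" "t \<le> 1" "t * dist u v = h" using False h by (simp_all add: t_def)
      have w: "w \<in> closed_segment u v" using t unfolding in_segment w_def by blast
      have diff: "u - w = t *\<^sub>R (u - v)" "w - v = (1 - t) *\<^sub>R (u - v)"
        by (simp_all add: w_def algebra_simps)
      have d: "dist u w = h" "dist w v = dist u v - h"
        unfolding dist_norm[of u w] dist_norm[of w v] diff norm_scaleR
        using t by (simp_all add: dist_norm left_diff_distrib)
      have sub: "closed_segment u w \<subseteq> closed_segment u v" "closed_segment w v \<subseteq> closed_segment u v"
        using w by (simp_all add: subset_closed_segment)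
      have "\<bar>Im (contour_integral (linepath u w) (log_deriv f))\<bar> \<le> C"
        
      proof -
        have "closed_segment u w \<inter> (zeros \<union> pole_set f) = {}" using sub(1) Suc.prems(2) by blast
        then show ?thesis using short[of u w] d(1) by (simp add: C_def)
      qed
      moreover have "\<bar>Im (contour_integral (linepath w v) (log_deriv f))\<bar> \<le> real n * C"
      proof (rule Suc.IH)
        show "dist w v \<le> real n * h" using Suc.prems(1) d(2) by (simp add: distrib_right)
        show "closed_segment w v \<inter> (zeros \<union> pole_set f) = {}" using sub(2) Suc.prems(2) by blast
      qed
      moreover have "contour_integral (linepath u v) (log_deriv f)
          = contour_integral (linepath u w) (log_deriv f) + contour_integral (linepath w v) (log_deriv f)"
        by (rule contour_integral_split_linepath[OF continuous_log_deriv[OF Suc.prems(2)] w])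
      ultimately show ?thesis by (simp add: distrib_right)
    qed
  qed auto
  then show ?thesis using that[OF h, of C] by (simp add: C_def)
qed

text \<open>The principal arguments at the two ends contribute at most \<pi> each, which is the
  summand 1 after division by \<open>2 * pi\<close>.\<close>

lemma flow_bound:
  obtains h C where "h > 0" "C \<ge> 0"
    "\<And>n u v. \<lbrakk>dist u v \<le> real n * h; closed_segment u v \<inter> (zeros \<union> pole_set f) = {}\<rbrakk>
     \<Longrightarrow> \<bar>real_of_int (flow u v)\<bar> \<le> real n * C + 1"
proof -
  obtain h C where hC: "h > 0" "C \<ge> 0"
    and b: "\<And>n u v. \<lbrakk>dist u v \<le> real n * h; closed_segment u v \<inter> (zeros \<union> pole_set f) = {}\<rbrakk>
     \<Longrightarrow> \<bar>Im (contour_integral (linepath u v) (log_deriv f))\<bar> \<le> real n * C"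
    using segment_bound by metis
  have "\<bar>real_of_int (flow u v)\<bar> \<le> real n * (C / (2 * pi)) + 1"
    if uv: "dist u v \<le> real n * h" "closed_segment u v \<inter> (zeros \<union> pole_set f) = {}" for n u v
  proof -
    have th: "\<bar>Im (Ln (the (f z)))\<bar> \<le> pi" if "z \<in> closed_segment u v" for z
    proof -
      have "the (f z) \<noteq> 0" using the_eq_0_iff[of z] uv(2) that by blast
      then show ?thesis using mpi_less_Im_Ln[of "the (f z)"] Im_Ln_le_pi[of "the (f z)"] by linarith
    qed
    have "\<bar>2 * pi * of_int (flow u v)\<bar> \<le> real n * C + 2 * pi"
      unfolding flow_eq[OF uv(2)] using b[OF uv] th[of u] th[of v] by simp
    then have "2 * pi * \<bar>real_of_int (flow u v)\<bar> \<le> 2 * pi * (real n * (C / (2 * pi)) + 1)"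
      by (simp add: abs_mult algebra_simps)
    then show ?thesis by simp
  qed
  then show ?thesis using that[of h "C / (2 * pi)"] hC by simp
qed

end

subsection \<open>The matching\<close>

text \<open>Points with multiplicity are encoded as pairs \<open>(w, k)\<close> with
  \<open>k < m w\<close>; the first components of an enumeration of these pairs repeat each
  \<open>w\<close> exactly \<open>m w\<close> times.\<close>

lemma count_fibre_of_enumeration:
  assumes e: "bij_betw e UNIV {(w, k). k < m w}"
  shows "finite {n. fst (e n) = v} \<and> card {n. fst (e n) = v} = m v"
proof -
  have "bij_betw e {n. fst (e n) = v} (Pair v ` {..<m v})"
  proof (rule bij_betw_subset[OF e])
    show "e ` {n. fst (e n) = v} = Pair v ` {..<m v}"
    proof (intro set_eqI iffI)
      fix x assume "x \<in> e ` {n. fst (e n) = v}"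
      then obtain n where n: "x = e n" "fst (e n) = v" by blast
      have "e n \<in> {(w, k). k < m w}" by (rule bspec[OF bij_betwE[OF e] UNIV_I])
      then show "x \<in> Pair v ` {..<m v}" using n by (cases x) auto
    next
      fix x assume x: "x \<in> Pair v ` {..<m v}"
      then have "x \<in> e ` UNIV" using e by (auto simp: bij_betw_def)
      then show "x \<in> e ` {n. fst (e n) = v}" using x by auto
    qed
  qed simp
  then show ?thesis
    using bij_betw_finite bij_betw_same_card card_image[of "Pair v" "{..<m v}"]
    by (metis (no_types, lifting) card_lessThan finite_imageI finite_lessThan inj_onI prod.inject)
qed

lemma exists_real_off_lattice_translates:
  fixes A :: "real set"
  assumes "countable A"
  obtains s where "\<And>i::int. s + S * of_int i \<notin> A"
proof -
  have "countable ((\<lambda>(x, i::int). x - S * of_int i) ` (A \<times> UNIV))"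
    using assms by (intro countable_image countable_SIGMA) auto
  then obtain s where s: "s \<notin> (\<lambda>(x, i::int). x - S * of_int i) ` (A \<times> UNIV)"
    using uncountable_UNIV_real by (metis UNIV_I countable_subset subsetI)
  have "s + S * of_int i \<notin> A" for i :: int
  proof
    assume "s + S * of_int i \<in> A"
    then have "(\<lambda>(x, i::int). x - S * of_int i) (s + S * of_int i, i) \<in> (\<lambda>(x, i::int). x - S * of_int i) ` (A \<times> UNIV)"
      by (intro imageI) auto
    then show False using s by simp
  qed
  then show ?thesis using that by blast
qed

lemma floor_divide_eq_open_iff:
  fixes x s S :: real
  assumes "S > 0" "\<And>k::int. x \<noteq> s + S * of_int k"
  shows "\<lfloor>(x - s) / S\<rfloor> = i \<longleftrightarrow> s + S * of_int i < x \<and> x < s + S * of_int (i + 1)"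
  using assms(1) assms(2)[of i] by (auto simp: floor_eq_iff field_simps order_less_le)

section \<open>Squares rich in zeros and the choice of the grid\<close>

context almost_elliptic_fun
begin

text \<open>The square is cut into \<open>m\<^sup>2\<close> squares of side \<open>3 * L\<close>,
  each of which contains a disc of radius \<open>L\<close> at positive distance from its boundary.
  The zeros found in these discs are distinct, since \<open>g\<close> recovers the index of the
  small square.\<close>

lemma many_zeros_in_large_squares:
  obtains L where "L > 0"
    "\<And>m c. \<exists>A. finite A \<and> A \<subseteq> zeros \<inter> box c (c + Complex (L * real m) (L * real m)) \<and> m\<^sup>2 \<le> card A"
proof -
  obtain L where L: "L > 0" and dense: "\<And>c. \<exists>z\<in>cball c L. z \<in> zeros"
    using zeros_relatively_dense by metis
  have "\<exists>A. finite A \<and> A \<subseteq> zeros \<inter> box c (c + Complex (3 * L * real m) (3 * L * real m)) \<and> m\<^sup>2 \<le> card A" for m c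
  proof -
    let ?I = "{..<m} \<times> {..<m}"
    define ctr where "ctr = (\<lambda>(p::nat, q::nat). c + Complex (3 * L * (real p + 1/2)) (3 * L * (real q + 1/2)))"
    have "\<forall>x. \<exists>z. z \<in> cball (ctr x) L \<and> z \<in> zeros" using dense by blast
    then obtain z where z: "\<And>x. z x \<in> cball (ctr x) L" "\<And>x. z x \<in> zeros" by metis
    define g where "g = (\<lambda>w. (nat \<lfloor>(Re w - Re c) / (3 * L)\<rfloor>, nat \<lfloor>(Im w - Im c) / (3 * L)\<rfloor>))"
    have coord: "3 * L * real p < Re (z (p, q)) - Re c \<and> Re (z (p, q)) - Re c < 3 * L * real (p + 1)
        \<and> 3 * L * real q < Im (z (p, q)) - Im c \<and> Im (z (p, q)) - Im c < 3 * L * real (q + 1)" for p q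
    proof -
      have n: "norm (z (p, q) - ctr (p, q)) \<le> L" using z(1)[of "(p, q)"] by (simp add: dist_norm norm_minus_commute)
      have "\<bar>Re (z (p, q) - ctr (p, q))\<bar> \<le> L" "\<bar>Im (z (p, q) - ctr (p, q))\<bar> \<le> L"
        using abs_Re_le_cmod abs_Im_le_cmod n order_trans by blast+
      then show ?thesis using L by (simp add: ctr_def abs_le_iff algebra_simps)
    qed
    have gz: "g (z (p, q)) = (p, q)" for p q
    proof -
      have "\<lfloor>(Re (z (p, q)) - Re c) / (3 * L)\<rfloor> = int p" "\<lfloor>(Im (z (p, q)) - Im c) / (3 * L)\<rfloor> = int q"
        using coord[of p q] L by (simp_all add: floor_eq_iff field_simps)
      then show ?thesis by (simp add: g_def)
    qed
    have "inj_on z ?I" by (rule inj_on_inverseI[of _ g]) (auto simp: gz)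
    then have "card (z ` ?I) = m\<^sup>2" by (simp add: card_image card_cartesian_product power2_eq_square)
    moreover have "z (p, q) \<in> box c (c + Complex (3 * L * real m) (3 * L * real m))" if "p < m" "q < m" for p q
    proof -
      have "3 * L * real (p + 1) \<le> 3 * L * real m" "3 * L * real (q + 1) \<le> 3 * L * real m"
        using that L by (intro mult_left_mono; simp)+
      moreover have "0 \<le> 3 * L * real p" "0 \<le> 3 * L * real q" using L by simp_all
      ultimately show ?thesis using coord[of p q] unfolding in_box_complex_iff by simp
    qed
    ultimately show ?thesis using z(2) by (intro exI[of _ "z ` ?I"]) auto
  qed
  then show ?thesis using that[of "3 * L"] L by simp
qed

text \<open>The flow across an edge is at most proportional to its length, whereas the number of zeros in a
  square grows with its area; hence large squares contain enough zeros to feed the flow.\<close>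
lemma grid_with_small_flow:
  obtains S s t :: real and K :: int
  where "S > 0"
    "\<And>w i. w \<in> zeros \<union> pole_set f \<Longrightarrow> Re w \<noteq> s + S * of_int (i::int)"
    "\<And>w i. w \<in> zeros \<union> pole_set f \<Longrightarrow> Im w \<noteq> t + S * of_int (i::int)"
    "\<And>u v. dist u v \<le> S \<Longrightarrow> closed_segment u v \<inter> (zeros \<union> pole_set f) = {} \<Longrightarrow> \<bar>flow u v\<bar> \<le> K"
    "K \<ge> 1"
    "\<And>c. \<exists>A. finite A \<and> A \<subseteq> zeros \<inter> box c (c + Complex S S) \<and> 4 * K \<le> int (card A)"
proof -
  obtain L where L: "L > 0" and many: "\<And>m c. \<exists>A. finite A \<and>
      A \<subseteq> zeros \<inter> box c (c + Complex (L * real m) (L * real m)) \<and> m\<^sup>2 \<le> card A"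
    using many_zeros_in_large_squares by metis
  obtain h C where h: "h > 0" "C \<ge> 0" and fb: "\<And>n u v. \<lbrakk>dist u v \<le> real n * h; closed_segment u v \<inter> (zeros \<union> pole_set f) = {}\<rbrakk>
     \<Longrightarrow> \<bar>real_of_int (flow u v)\<bar> \<le> real n * C + 1"
    using flow_bound by metis
  obtain k :: nat where k: "L / h \<le> real k" using real_arch_simple by blast
  then have Lk: "L \<le> real k * h" using h by (simp add: field_simps)
  define B where "B = real k * C"
  have "0 \<le> B" using h(2) by (simp add: B_def)
  \<comment> \<open>Since \<open>L \<le> real k * h\<close>, an edge of length \<open>S\<close>
    consists of at most \<open>k * m\<close> steps of length \<open>h\<close>. Hence
    \<open>4 * K \<le> 4 * (B + 1) * m\<close>, which \<open>m\<^sup>2\<close> exceeds; the extra 1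
    gives \<open>m \<ge> 1\<close>.\<close>
  obtain m :: nat where m: "4 * (B + 1) + 1 \<le> real m" using real_arch_simple by blast
  have "1 \<le> 4 * (B + 1) + 1" using \<open>0 \<le> B\<close> by simp
  then have m1: "1 \<le> real m" using m by (rule order_trans)
  define S where "S = L * real m"
  define K where "K = \<lfloor>real (k * m) * C + 1\<rfloor>"
  have S: "S > 0" using L m1 by (simp add: S_def)
  have countable: "countable (zeros \<union> pole_set f)"
    using no_limpt_imp_countable[OF no_limpt_zeros] no_limpt_imp_countable[OF no_limpt_poles] by blast
  obtain s where s: "\<And>i::int. s + S * of_int i \<notin> Re ` (zeros \<union> pole_set f)"
    using exists_real_off_lattice_translates[of "Re ` (zeros \<union> pole_set f)" S] countable_image[OF countable] by metis
  obtain t where t: "\<And>i::int. t + S * of_int i \<notin> Im ` (zeros \<union> pole_set f)"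
    using exists_real_off_lattice_translates[of "Im ` (zeros \<union> pole_set f)" S] countable_image[OF countable] by metis
  show ?thesis
  proof (rule that[of S s t K])
    show "S > 0" by (rule S)
    show "Re w \<noteq> s + S * of_int i" if "w \<in> zeros \<union> pole_set f" for w i using s[of i] that by force
    show "Im w \<noteq> t + S * of_int i" if "w \<in> zeros \<union> pole_set f" for w i using t[of i] that by force
    show "\<bar>flow u v\<bar> \<le> K" if "dist u v \<le> S" "closed_segment u v \<inter> (zeros \<union> pole_set f) = {}" for u v
    proof -
      have "S \<le> real (k * m) * h"
        using mult_right_mono[OF Lk, of "real m"] by (simp add: S_def mult_ac)
      then have "\<bar>real_of_int (flow u v)\<bar> \<le> real (k * m) * C + 1" using that by (intro fb) auto
      then show ?thesis unfolding K_def le_floor_iff by simp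
    qed
    show "K \<ge> 1" using h(2) unfolding K_def by (simp add: le_floor_iff)
    show "\<exists>A. finite A \<and> A \<subseteq> zeros \<inter> box c (c + Complex S S) \<and> 4 * K \<le> int (card A)" for c
    proof -
      obtain A where A: "finite A" "A \<subseteq> zeros \<inter> box c (c + Complex S S)" "m\<^sup>2 \<le> card A"
        using many[of c m] unfolding S_def by blast
      have "real_of_int (4 * K) \<le> 4 * (real (k * m) * C + 1)" unfolding K_def by simp
      also have "\<dots> \<le> 4 * (real (k * m) * C + real m)" using m1 by simp
      also have "\<dots> = 4 * (B + 1) * real m" by (simp add: B_def algebra_simps)
      also have "\<dots> \<le> real m * real m" using m m1 by (intro mult_right_mono) auto
      also have "\<dots> = real (m\<^sup>2)" by (simp add: power2_eq_square)
      also have "\<dots> \<le> real (card A)" using A(3) by simp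
      finally have "4 * K \<le> int (card A)" by linarith
      then show ?thesis using A by blast
    qed
  qed
qed

end

theorem mainTheorem6:
  fixes f :: "complex \<Rightarrow> complex option"
  assumes "almost_elliptic f"
  shows "\<exists>a b :: nat \<Rightarrow> complex.
           (\<forall>w. finite {n. a n = w} \<and> card {n. a n = w} = zero_mult f w) \<and>
           (\<forall>w. finite {n. b n = w} \<and> card {n. b n = w} = pole_mult f w) \<and>
           (\<exists>M::real. \<forall>n. norm (a n - b n) \<le> M)"
proof -
  interpret almost_elliptic_fun f by unfold_locales (rule assms)
  let ?D = "zeros \<union> pole_set f"
  obtain S s t :: real and K :: int where S: "S > 0"
    and off_Re: "\<And>w i. w \<in> ?D \<Longrightarrow> Re w \<noteq> s + S * of_int (i::int)"
    and off_Im: "\<And>w i. w \<in> ?D \<Longrightarrow> Im w \<noteq> t + S * of_int (i::int)"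
    and small: "\<And>u v. dist u v \<le> S \<Longrightarrow> closed_segment u v \<inter> ?D = {} \<Longrightarrow> \<bar>flow u v\<bar> \<le> K"
    and K: "K \<ge> 1"
    and many: "\<And>c. \<exists>A. finite A \<and> A \<subseteq> zeros \<inter> box c (c + Complex S S) \<and> 4 * K \<le> int (card A)"
    using grid_with_small_flow by metis
  define V where "V = (\<lambda>i j :: int. Complex (s + S * of_int i) (t + S * of_int j))"
  define cell where "cell = (\<lambda>w. (\<lfloor>(Re w - s) / S\<rfloor>, \<lfloor>(Im w - t) / S\<rfloor>))"
  \<comment> \<open>Divisor points avoid the grid lines, so the half-open cells given by floors may
    be replaced by open boxes, as the argument principle needs.\<close>
  have cell_iff: "cell w = (i, j) \<longleftrightarrow> w \<in> box (V i j) (V (i + 1) (j + 1))" if "w \<in> ?D" for w i j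
    using floor_divide_eq_open_iff[OF S off_Re[OF that], of i] floor_divide_eq_open_iff[OF S off_Im[OF that], of j]
    by (auto simp: cell_def V_def in_box_complex_iff)
  define Q where "Q = (\<lambda>i j. box (V i j) (V (i + 1) (j + 1)) \<inter> ?D)"
  have finQ: "finite (Q i j)" for i j
    unfolding Q_def by (rule finite_zeros_poles_bounded) simp
  define ZZ where "ZZ = {(w, k). k < zero_mult f w}"
  define PP where "PP = {(w, k). k < pole_mult f w}"
  have fibZ: "{x \<in> ZZ. cell (fst x) = (i, j)} = Sigma (Q i j) (\<lambda>w. {..<zero_mult f w})" for i j
  proof -
    have "w \<in> ?D" if "k < zero_mult f w" for w k using that zero_mult_pos_iff[of w] by auto
    then show ?thesis using cell_iff by (auto simp: ZZ_def Q_def)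
  qed
  have fibP: "{x \<in> PP. cell (fst x) = (i, j)} = Sigma (Q i j) (\<lambda>w. {..<pole_mult f w})" for i j
  proof -
    have "w \<in> ?D" if "k < pole_mult f w" for w k using that pole_mult_pos_iff[of w] by auto
    then show ?thesis using cell_iff by (auto simp: PP_def Q_def)
  qed
  have cardZ: "card {x \<in> ZZ. cell (fst x) = (i, j)} = (\<Sum>w\<in>Q i j. zero_mult f w)" for i j
    unfolding fibZ using finQ by simp
  have cardP: "card {x \<in> PP. cell (fst x) = (i, j)} = (\<Sum>w\<in>Q i j. pole_mult f w)" for i j
    unfolding fibP using finQ by simp

  have Hseg: "closed_segment (V i j) (V (i + 1) j) \<inter> ?D = {}" for i j
    using off_Im[of _ j] by (auto simp: V_def closed_segment_same_Im)
  have Wseg: "closed_segment (V i j) (V i (j + 1)) \<inter> ?D = {}" for i j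
    using off_Re[of _ i] by (auto simp: V_def closed_segment_same_Re)
  define H where "H = (\<lambda>i j. flow (V i j) (V (i + 1) j))"
  define W where "W = (\<lambda>i j. flow (V i j) (V i (j + 1)))"
  have VH: "V (i + 1) j - V i j = of_real S" and VW: "V i (j + 1) - V i j = \<i> * of_real S" for i j
    by (simp_all add: V_def complex_eq_iff algebra_simps)
  have HK: "\<bar>H i j\<bar> \<le> K" for i j
    unfolding H_def using S VH[of i j] by (intro small Hseg, subst dist_commute) (simp add: dist_norm)
  have WK: "\<bar>W i j\<bar> \<le> K" for i j
    unfolding W_def using S VW[of i j] by (intro small Wseg, subst dist_commute) (simp add: dist_norm norm_mult)
  have bal: "int (card {x \<in> ZZ. cell (fst x) = (i, j)}) - int (card {x \<in> PP. cell (fst x) = (i, j)})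
      = H i j + W (i + 1) j - H i (j + 1) - W i j" for i j
  proof -
    let ?a = "V i j" and ?b = "V (i + 1) (j + 1)"
    let ?I = "\<lambda>u v. contour_integral (linepath u v) (log_deriv f)"
    have ab: "Re ?a < Re ?b" "Im ?a < Im ?b" using S by (simp_all add: V_def)
    have corners: "Complex (Re ?b) (Im ?a) = V (i + 1) j" "Complex (Re ?a) (Im ?b) = V i (j + 1)"
      by (simp_all add: V_def)
    have "path_image (rectpath ?a ?b) = closed_segment ?a (V (i+1) j) \<union> closed_segment (V (i+1) j) ?b
        \<union> closed_segment (V i (j+1)) ?b \<union> closed_segment ?a (V i (j+1))"
      unfolding rectpath_def Let_def corners by (simp add: path_image_join Un_assoc closed_segment_commute)
    then have avoid: "path_image (rectpath ?a ?b) \<inter> ?D = {}"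
      using Hseg[of i j] Hseg[of i "j+1"] Wseg[of i j] Wseg[of "i+1" j] by blast
    have "2 * pi * of_int (\<Sum>p\<in>Q i j. mero_order f p) = Im (contour_integral (rectpath ?a ?b) (log_deriv f))"
      unfolding rectangle_argument_principle[OF ab avoid] Q_def by simp
    also have "\<dots> = Im (?I ?a (V (i+1) j)) + Im (?I (V (i+1) j) ?b) - Im (?I (V i (j+1)) ?b) - Im (?I ?a (V i (j+1)))"
      unfolding contour_integral_rectpath[OF avoid] corners by simp
    \<comment> \<open>The principal argument at each corner occurs twice with opposite signs and
      cancels.\<close>
    also have "\<dots> = 2 * pi * of_int (H i j + W (i + 1) j - H i (j + 1) - W i j)"
      using flow_eq[OF Hseg[of i j]] flow_eq[OF Hseg[of i "j+1"]] flow_eq[OF Wseg[of i j]] flow_eq[OF Wseg[of "i+1" j]]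
      unfolding H_def W_def by (simp add: algebra_simps)
    finally have "(\<Sum>p\<in>Q i j. mero_order f p) = H i j + W (i + 1) j - H i (j + 1) - W i j"
      by (simp only: mult_cancel_left of_int_eq_iff) simp
    moreover have "int (zero_mult f p) - int (pole_mult f p) = mero_order f p" for p
      by (simp add: zero_mult_def pole_mult_def)
    then have "(\<Sum>p\<in>Q i j. mero_order f p) = int (\<Sum>p\<in>Q i j. zero_mult f p) - int (\<Sum>p\<in>Q i j. pole_mult f p)"
      by (simp flip: sum_subtractf)
    ultimately show ?thesis unfolding cardZ cardP by simp
  qed
  have manyZ: "4 * K \<le> int (card {x \<in> ZZ. cell (fst x) = q})" for q
  proof (cases q)
    case (Pair i j)
    have "V (i + 1) (j + 1) = V i j + Complex S S" by (simp add: V_def complex_eq_iff algebra_simps)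
    then obtain A where A: "A \<subseteq> zeros \<inter> box (V i j) (V (i + 1) (j + 1))" "4 * K \<le> int (card A)"
      using many[of "V i j"] by auto
    \<comment> \<open>Distinct zeros suffice for the lower bound, each having multiplicity at least
      1.\<close>
    have "card A \<le> card (Q i j \<inter> zeros)" using A(1) finQ by (intro card_mono) (auto simp: Q_def)
    also have "\<dots> = (\<Sum>w\<in>Q i j \<inter> zeros. 1)" by simp
    also have "\<dots> \<le> (\<Sum>w\<in>Q i j \<inter> zeros. zero_mult f w)"
      using zero_mult_pos_iff by (intro sum_mono) (auto simp: Suc_le_eq)
    also have "\<dots> \<le> (\<Sum>w\<in>Q i j. zero_mult f w)" by (intro sum_mono2 finQ) auto
    finally show ?thesis using A(2) unfolding Pair cardZ by linarith
  qed
  obtain \<phi> where \<phi>: "bij_betw \<phi> ZZ PP"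
    and near: "\<And>x. x \<in> ZZ \<Longrightarrow> \<bar>fst (cell (fst (\<phi> x))) - fst (cell (fst x))\<bar> \<le> 1
        \<and> \<bar>snd (cell (fst (\<phi> x))) - snd (cell (fst x))\<bar> \<le> 1"
  proof (rule bounded_transport[where Z = ZZ and P = PP and cz = "\<lambda>x. cell (fst x)"
        and cp = "\<lambda>x. cell (fst x)" and H = H and W = W and K = K])
    show "finite {x \<in> ZZ. cell (fst x) = q}" for q
      by (cases q) (simp add: fibZ finQ)
    show "finite {x \<in> PP. cell (fst x) = q}" for q
      by (cases q) (simp add: fibP finQ)
  qed (use bal HK WK manyZ in blast)+
  have "countable ZZ"
  proof (rule countable_subset)
    show "ZZ \<subseteq> zeros \<times> UNIV" using zero_mult_pos_iff by (auto simp: ZZ_def dest: order_le_less_trans[OF le0])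
    show "countable (zeros \<times> (UNIV :: nat set))"
      using no_limpt_imp_countable[OF no_limpt_zeros] by (intro countable_SIGMA) auto
  qed
  \<comment> \<open>As \<open>K \<ge> 1\<close>, each of the infinitely many cells contains a zero;
    this allows indexing by all natural numbers.\<close>
  moreover have "infinite ZZ"
  proof
    assume "finite ZZ"
    then have "finite ((\<lambda>x. cell (fst x)) ` ZZ)" by simp
    moreover have "q \<in> (\<lambda>x. cell (fst x)) ` ZZ" for q
    proof -
      have "{x \<in> ZZ. cell (fst x) = q} \<noteq> {}" using manyZ[of q] K by (metis card.empty int_ops(1) linorder_not_le mult_pos_pos order_less_le_trans zero_less_numeral zero_less_one)
      then show ?thesis by blast
    qed
    then have "(\<lambda>x. cell (fst x)) ` ZZ = UNIV" by blast
    ultimately have "finite (UNIV :: (int \<times> int) set)" by simp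
    then show False by (simp add: finite_prod)
  qed
  ultimately have e: "bij_betw (from_nat_into ZZ) UNIV ZZ" by (rule bij_betw_from_nat_into)
  define e where "e = from_nat_into ZZ"
  have eZ: "bij_betw e UNIV ZZ" using e by (simp add: e_def)
  have eP: "bij_betw (\<lambda>n. \<phi> (e n)) UNIV PP" using bij_betw_trans[OF eZ \<phi>] by (simp add: o_def)
  \<comment> \<open>Cell indices differing by at most 1 put each coordinate within
    \<open>2 * S\<close>, and the norm is at most the sum of both coordinates.\<close>
  have close: "norm (fst (e n) - fst (\<phi> (e n))) \<le> 4 * S" for n
  proof -
    define u v where "u = fst (e n)" and "v = fst (\<phi> (e n))"
    have fl: "\<bar>x - y\<bar> \<le> 2 * S" if "\<bar>\<lfloor>(y - c) / S\<rfloor> - \<lfloor>(x - c) / S\<rfloor>\<bar> \<le> 1" for x y c :: real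
    proof -
      have "\<bar>(y - c) / S - (x - c) / S\<bar> \<le> 2" using that by linarith
      moreover have "(y - c) / S - (x - c) / S = (y - x) / S" by (simp add: diff_divide_distrib)
      ultimately show ?thesis using S by (simp add: abs_divide field_simps abs_minus_commute)
    qed
    have "e n \<in> ZZ" using eZ bij_betwE by blast
    from near[OF this] have "\<bar>Re u - Re v\<bar> \<le> 2 * S" "\<bar>Im u - Im v\<bar> \<le> 2 * S"
      by (auto simp: cell_def u_def v_def intro: fl)
    then show ?thesis using cmod_le[of "u - v"] by (simp add: u_def v_def)
  qed
  show ?thesis
    using count_fibre_of_enumeration[OF eZ[unfolded ZZ_def]] count_fibre_of_enumeration[OF eP[unfolded PP_def]] close
    by (intro exI[of _ "\<lambda>n. fst (e n)"] exI[of _ "\<lambda>n. fst (\<phi> (e n))"]) blast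
qed

end
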